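(* Let $0<\varepsilon<\infty$, $0<s<\infty$, $0<\ell<\infty$, and let $n$ be such that $0<n<\ell/s$. Let $\{B_t\}_{t\ge0}$ and $\{N_t\}_{t\ge0}$ be two independent standard Wiener processes, and define $X_0=0$, $X_t=B_t+st$ and $Y_0=0$, $Y_t=X_t+\varepsilon N_t$ for real $t>0$. Let $\tau_\ell=\inf\{t\ge 0: X_t\ge \ell\}$. Then $$ \inf_{\eta(Y_0^{\infty})}\mathbb{E}|\eta-\tau_\ell| \geq \sqrt{\frac{2n\varepsilon^2}{\pi s^2(1+\varepsilon^2)}}-\left(\frac{2n}{\pi^3s^6}\right)^{1/4}-\sqrt{\frac{2(\ell-sn)_+}{\pi s^3}}-\left(2n^{3/2}+\frac{n}{s}+\frac{n^{1/2}\ell}{s}\right)Q\!\left(\frac{\ell-sn}{\sqrt{n}}\right)^{1/2}, $$ where the infimum is over all estimators $\eta=\eta(Y_0^\infty)$, i.e. all (measurable) functions of the entire observation process $Y_0^\infty=\{Y_t\}_{t\ge0}$, not necessarily stopping times.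
   Context: Time $t$ is continuous, ranging over $[0,\infty)$. Standard Wiener processes start at $0$. Notation: $x_+=\max\{0,x\}$ and $Q(x)=\frac{1}{\sqrt{2\pi}}\int_x^\infty \exp(-u^2/2)\,du$; $Q(x)^{1/2}$ is the square root of $Q(x)$. *)

theory Defs
  imports "HOL-Probability.Probability"
begin

text \<open>
  A process is a function of time and outcome, of which only the values at times
  \<open>t \<ge> 0\<close> matter.  Starting at \<open>0\<close> and continuity of the paths are required almost surely.
\<close>

locale standard_wiener_process = prob_space M for M :: "'a measure" +
  fixes W :: "real \<Rightarrow> 'a \<Rightarrow> real"
  assumes random_variable_at: "\<And>t. 0 \<le> t \<Longrightarrow> random_variable borel (W t)"
    and start_at_zero: "AE \<omega> in M. W 0 \<omega> = 0"
    and indep_increments: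
      "\<And>(k::nat) (t::nat \<Rightarrow> real). 0 \<le> t 0 \<Longrightarrow> (\<And>i. i < k \<Longrightarrow> t i < t (Suc i)) \<Longrightarrow>
         indep_vars (\<lambda>_. borel) (\<lambda>i \<omega>. W (t (Suc i)) \<omega> - W (t i) \<omega>) {..<k}"
    and normal_increments:
      "\<And>u v. 0 \<le> u \<Longrightarrow> u < v \<Longrightarrow>
         distributed M lborel (\<lambda>\<omega>. W v \<omega> - W u \<omega>) (normal_density 0 (sqrt (v - u)))"
    and continuous_paths: "AE \<omega> in M. continuous_on {0..} (\<lambda>t. W t \<omega>)"

abbreviation path_space :: "(real \<Rightarrow> real) measure" where
  "path_space \<equiv> Pi\<^sub>M {0..} (\<lambda>_. borel)"

definition sample_path :: "(real \<Rightarrow> 'a \<Rightarrow> real) \<Rightarrow> 'a \<Rightarrow> real \<Rightarrow> real" where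
  "sample_path Z \<omega> = (\<lambda>t\<in>{0..}. Z t \<omega>)"

definition indep_processes ::
    "'a measure \<Rightarrow> (real \<Rightarrow> 'a \<Rightarrow> real) \<Rightarrow> (real \<Rightarrow> 'a \<Rightarrow> real) \<Rightarrow> bool" where
  "indep_processes M V W \<longleftrightarrow>
     prob_space.indep_var M path_space (sample_path V) path_space (sample_path W)"

text \<open>Extended-real valued, so that the hitting time is \<open>\<infinity>\<close> if the level is never reached.\<close>

definition hitting_time :: "(real \<Rightarrow> 'a \<Rightarrow> real) \<Rightarrow> real \<Rightarrow> 'a \<Rightarrow> ereal" where
  "hitting_time Z l \<omega> = Inf (ereal ` {t. 0 \<le> t \<and> l \<le> Z t \<omega>})"

text \<open>
  The mean absolute error, for an estimator that is a function of the whole path of the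
  observed process.  It is a nonnegative integral, so it is \<open>\<infinity>\<close> rather than \<open>0\<close> if the
  error is not integrable.
\<close>

definition mean_abs_error ::
    "'a measure \<Rightarrow> (real \<Rightarrow> 'a \<Rightarrow> real) \<Rightarrow> ('a \<Rightarrow> ereal) \<Rightarrow> ((real \<Rightarrow> real) \<Rightarrow> real) \<Rightarrow> ennreal" where
  "mean_abs_error M Y \<tau> \<eta> =
     (\<integral>\<^sup>+ \<omega>. e2ennreal \<bar>ereal (\<eta> (sample_path Y \<omega>)) - \<tau> \<omega>\<bar> \<partial>M)"

definition gaussian_Q :: "real \<Rightarrow> real" where
  "gaussian_Q x = 1 / sqrt (2 * pi) * (LINT u:{x..}|lborel. exp (- (u\<^sup>2) / 2))"

end

theory Submission
  imports Defs "HOL-Real_Asymp.Real_Asymp"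
begin

text \<open>
  The estimation error is bounded below by duality.  The noise \<open>V = \<epsilon> B\<^sub>n - N\<^sub>n\<close> is independent of
  the whole observation, because reflecting the pair \<open>(B, N)\<close> about the direction of \<open>B + \<epsilon> N\<close>
  preserves its law and negates \<open>V\<close>.  Hence \<open>E[\<eta> sgn V] = 0\<close> for every bounded estimator \<open>\<eta>\<close>, and
  \<open>E|\<eta> - \<tau>| \<ge> - E[\<tau> sgn V]\<close>.  Since \<open>s \<tau> = l - B\<^sub>\<tau>\<close>, the right-hand side is \<open>E[B\<^sub>\<tau> sgn V] / s\<close>.  Replacing
  \<open>B\<^sub>\<tau>\<close> by \<open>B\<^sub>n\<close> gives the first term of the bound.  By optional stopping this replacement costs
  nothing on \<open>\<tau> > n\<close>, and on \<open>\<tau> \<le> n\<close> it costs at most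
  \<open>E|B\<^sub>n - B\<^sub>\<tau>| = \<surd>(2/\<pi>) E \<surd>(n - \<tau>)\<^sub>+ \<le> \<surd>(2/\<pi>) \<surd>(E (n - \<tau>)\<^sub>+)\<close>, where \<open>s E (n - \<tau>)\<^sub>+ \<le> E (B\<^sub>n)\<^sub>+\<close>;
  this is the second term, so the remaining two terms of the bound, being nonpositive, can be
  dropped.  All of this is carried out for a random walk on a grid, where the optional stopping
  arguments are finite sums; the mesh then tends to \<open>0\<close>.
\<close>

text \<open>The pairing with sgn V rests only on V being odd under the reflection; it is checked on
  functions of finitely many increments and then extended to the whole path, future included, so no
  filtration of the observation is involved. The sign is the natural dual weight: it is bounded by 1
  and maximises E[V g(V)] among such weights. Three obstacles shape the passage to the limit.
  Neither the estimator nor \<tau> need be bounded, so both are cut at a horizon R n. On a grid the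
  walk overshoots the level or has not reached it by the horizon, so s \<tau> = l - B_\<tau> holds
  only up to errors that vanish in the limit. And a continuous path may touch l without crossing it,
  which a grid can miss, so l is approached by strictly smaller levels. The order of the limits is:
  mesh to 0, cutoff c for large increments to 0, levels up to l, R to infinity. The condition n < l
  / s is what bounds the time lost before n: a walk stopped by then has reached l, hence more than
  the drift accumulated up to n.\<close>

subsection \<open>Reflection invariance and independence of pairs\<close>

text \<open>Two one-dimensional substitutions suffice: p = c x + d y at fixed x and, after Fubini, x
  = c p + d q at fixed p. Each contributes a factor d, and the two cancel.\<close>

lemma nn_integral_lborel_reflection:
  fixes G :: "real \<times> real \<Rightarrow> ennreal" and c d :: real
  assumes G [measurable]: "G \<in> borel_measurable (borel \<Otimes>\<^sub>M borel)"
    and d: "0 < d" and cd: "c\<^sup>2 + d\<^sup>2 = 1"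
  shows "(\<integral>\<^sup>+x. \<integral>\<^sup>+y. G (c * x + d * y, d * x - c * y) \<partial>lborel \<partial>lborel)
       = (\<integral>\<^sup>+x. \<integral>\<^sup>+y. G (x, y) \<partial>lborel \<partial>lborel)" (is "?L = ?R")
proof -
  \<comment> \<open>With p = c x + d y this recovers the second coordinate as (x - c p) / d; here
    c^2 + d^2 = 1 enters.\<close>
  have y: "(x - c * (c * x + d * y)) / d = d * x - c * y" for x y
  proof -
    have "x - c * (c * x + d * y) = x * (1 - c\<^sup>2) - c * d * y"
      by (simp add: algebra_simps power2_eq_square)
    also have "\<dots> = d * (d * x - c * y)"
      using cd by (simp add: algebra_simps power2_eq_square flip: cd)
    finally show ?thesis using d by simp
  qed
  have "ennreal d * ?L = (\<integral>\<^sup>+x. ennreal d * (\<integral>\<^sup>+y. G (c * x + d * y, d * x - c * y) \<partial>lborel) \<partial>lborel)"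
    by (subst nn_integral_cmult) auto
  also have "\<dots> = (\<integral>\<^sup>+x. \<integral>\<^sup>+p. G (p, (x - c * p) / d) \<partial>lborel \<partial>lborel)"
  proof (intro nn_integral_cong)
    fix x :: real
    show "ennreal d * (\<integral>\<^sup>+y. G (c * x + d * y, d * x - c * y) \<partial>lborel)
        = (\<integral>\<^sup>+p. G (p, (x - c * p) / d) \<partial>lborel)"
      using d by (subst (2) nn_integral_real_affine[where c=d and t="c * x"]) (auto simp: y)
  qed
  also have "\<dots> = (\<integral>\<^sup>+p. \<integral>\<^sup>+x. G (p, (x - c * p) / d) \<partial>lborel \<partial>lborel)"
    by (rule lborel_pair.Fubini') simp
  also have "\<dots> = (\<integral>\<^sup>+p. ennreal d * (\<integral>\<^sup>+q. G (p, q) \<partial>lborel) \<partial>lborel)"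
  proof (intro nn_integral_cong)
    fix p :: real
    show "(\<integral>\<^sup>+x. G (p, (x - c * p) / d) \<partial>lborel) = ennreal d * (\<integral>\<^sup>+q. G (p, q) \<partial>lborel)"
      using d by (subst nn_integral_real_affine[where c=d and t="c * p"]) auto
  qed
  also have "\<dots> = ennreal d * ?R"
    by (subst nn_integral_cmult) auto
  finally show ?thesis
    using d by (simp add: ennreal_mult_cancel_left)
qed

text \<open>The joint density depends on x^2 + y^2 alone, and the reflection preserves both this
  quantity and Lebesgue measure.\<close>

lemma (in prob_space) distr_normal_reflection:
  fixes X Y :: "'a \<Rightarrow> real"
  assumes XY: "indep_var borel X borel Y" and \<sigma>: "0 < \<sigma>"
    and X: "distributed M lborel X (normal_density 0 \<sigma>)"
    and Y: "distributed M lborel Y (normal_density 0 \<sigma>)"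
    and d: "0 < d" and cd: "c\<^sup>2 + d\<^sup>2 = 1"
  shows "distr M (borel \<Otimes>\<^sub>M borel) (\<lambda>\<omega>. (c * X \<omega> + d * Y \<omega>, d * X \<omega> - c * Y \<omega>))
       = distr M (borel \<Otimes>\<^sub>M borel) (\<lambda>\<omega>. (X \<omega>, Y \<omega>))" (is "?L = ?R")
proof (rule measure_eqI)
  fix A assume "A \<in> sets ?L"
  then have A [measurable]: "A \<in> sets (borel \<Otimes>\<^sub>M borel)" by simp
  have [measurable]: "X \<in> borel_measurable M" "Y \<in> borel_measurable M"
    using X Y by (auto simp: distributed_def)
  have indep: "indep_var lborel X lborel Y"
    using XY by (simp add: indep_var_eq)
  let ?f = "normal_density 0 \<sigma>"
  have XY: "distributed M (lborel \<Otimes>\<^sub>M lborel) (\<lambda>\<omega>. (X \<omega>, Y \<omega>)) (\<lambda>(x, y). ennreal (?f x) * ennreal (?f y))"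
    by (rule distributed_joint_indep[OF _ _ X Y indep]) (auto intro: lborel.sigma_finite_measure_axioms)
  have E: "(\<integral>\<^sup>+\<omega>. h (X \<omega>, Y \<omega>) \<partial>M)
      = (\<integral>\<^sup>+x. \<integral>\<^sup>+y. ennreal (?f x * ?f y) * h (x, y) \<partial>lborel \<partial>lborel)"
    if [measurable]: "h \<in> borel_measurable (borel \<Otimes>\<^sub>M borel)" for h :: "real \<times> real \<Rightarrow> ennreal"
  proof -
    have [measurable]: "h \<in> borel_measurable (lborel \<Otimes>\<^sub>M lborel)"
      by measurable
    have "(\<integral>\<^sup>+\<omega>. h (X \<omega>, Y \<omega>) \<partial>M) = (\<integral>\<^sup>+z. (case z of (x, y) \<Rightarrow> ennreal (?f x) * ennreal (?f y)) * h z \<partial>(lborel \<Otimes>\<^sub>M lborel))"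
      by (rule distributed_nn_integral[OF XY, symmetric]) simp
    also have "\<dots> = (\<integral>\<^sup>+x. \<integral>\<^sup>+y. ennreal (?f x) * ennreal (?f y) * h (x, y) \<partial>lborel \<partial>lborel)"
      by (subst lborel.nn_integral_fst[symmetric]) simp_all
    finally show ?thesis by (simp add: ennreal_mult)
  qed
  have ff: "?f (c * x + d * y) * ?f (d * x - c * y) = ?f x * ?f y" for x y
  proof -
    have "(c * x + d * y)\<^sup>2 + (d * x - c * y)\<^sup>2 = (c\<^sup>2 + d\<^sup>2) * (x\<^sup>2 + y\<^sup>2)"
      by algebra
    then have "(c * x + d * y)\<^sup>2 + (d * x - c * y)\<^sup>2 = x\<^sup>2 + y\<^sup>2"
      by (simp add: cd)
    moreover have "?f u * ?f v = 1 / (2 * pi * \<sigma>\<^sup>2) * exp (- (u\<^sup>2 + v\<^sup>2) / (2 * \<sigma>\<^sup>2))" for u v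
    proof -
      have "?f u * ?f v = (1 / sqrt (2 * pi * \<sigma>\<^sup>2))\<^sup>2 * (exp (- u\<^sup>2 / (2 * \<sigma>\<^sup>2)) * exp (- v\<^sup>2 / (2 * \<sigma>\<^sup>2)))"
        by (simp add: normal_density_def power2_eq_square)
      also have "\<dots> = 1 / (2 * pi * \<sigma>\<^sup>2) * exp (- u\<^sup>2 / (2 * \<sigma>\<^sup>2) + - v\<^sup>2 / (2 * \<sigma>\<^sup>2))"
        by (simp only: exp_add) (simp add: power_divide)
      finally show ?thesis by (simp add: add_divide_distrib diff_divide_distrib)
    qed
    ultimately show ?thesis by simp
  qed
  let ?G = "\<lambda>(x, y). ennreal (?f x * ?f y) * indicator A (x, y)"
  have "emeasure ?L A = (\<integral>\<^sup>+\<omega>. indicator A (c * X \<omega> + d * Y \<omega>, d * X \<omega> - c * Y \<omega>) \<partial>M)"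
    by (subst nn_integral_indicator[symmetric], simp, subst nn_integral_distr) auto
  also have "\<dots> = (\<integral>\<^sup>+x. \<integral>\<^sup>+y. ennreal (?f x * ?f y) * indicator A (c * x + d * y, d * x - c * y) \<partial>lborel \<partial>lborel)"
    using E[of "\<lambda>(x, y). indicator A (c * x + d * y, d * x - c * y)"] by simp
  also have "\<dots> = (\<integral>\<^sup>+x. \<integral>\<^sup>+y. ?G (c * x + d * y, d * x - c * y) \<partial>lborel \<partial>lborel)"
    by (simp add: ff)
  also have "\<dots> = (\<integral>\<^sup>+x. \<integral>\<^sup>+y. ?G (x, y) \<partial>lborel \<partial>lborel)"
    by (rule nn_integral_lborel_reflection[OF _ d cd]) simp
  also have "\<dots> = (\<integral>\<^sup>+\<omega>. indicator A (X \<omega>, Y \<omega>) \<partial>M)"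
    using E[of "indicator A"] by simp
  also have "\<dots> = emeasure ?R A"
    by (subst nn_integral_indicator[symmetric], simp, subst nn_integral_distr) auto
  finally show "emeasure ?L A = emeasure ?R A" .
qed simp

text \<open>Rectangles generate the algebra of a pair and are stable under intersection. On
  rectangle events the probability factors first across the two families, by \<open>XY\<close>, and
  then over the index within each family.\<close>

lemma (in prob_space) indep_vars_Pair:
  assumes I: "finite I"
    and X: "indep_vars MA X I" and Y: "indep_vars MB Y I"
    and XY: "indep_var (PiM I MA) (\<lambda>\<omega>. \<lambda>i\<in>I. X i \<omega>) (PiM I MB) (\<lambda>\<omega>. \<lambda>i\<in>I. Y i \<omega>)"
  shows "indep_vars (\<lambda>i. MA i \<Otimes>\<^sub>M MB i) (\<lambda>i \<omega>. (X i \<omega>, Y i \<omega>)) I"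
proof -
  have [measurable]: "X i \<in> measurable M (MA i)" "Y i \<in> measurable M (MB i)" if "i \<in> I" for i
    using X Y that by (auto simp: indep_vars_def)
  define G where "G i = (\<lambda>(a, b). X i -` a \<inter> Y i -` b \<inter> space M) ` (sets (MA i) \<times> sets (MB i))" for i
  have GI: "X i -` a \<inter> Y i -` b \<inter> space M \<in> G i" if "a \<in> sets (MA i)" "b \<in> sets (MB i)" for i a b
    unfolding G_def by (rule rev_image_eqI[of "(a, b)"]) (use that in auto)
  have GE: "\<exists>p. fst p \<in> sets (MA i) \<and> snd p \<in> sets (MB i) \<and> A = X i -` fst p \<inter> Y i -` snd p \<inter> space M"
    if "A \<in> G i" for A i
  proof -
    from that obtain p where "p \<in> sets (MA i) \<times> sets (MB i)"
      "A = (\<lambda>(a, b). X i -` a \<inter> Y i -` b \<inter> space M) p"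
      unfolding G_def by (elim imageE)
    then show ?thesis
      by (intro exI[of _ p]) (simp add: case_prod_beta mem_Times_iff)
  qed
  have G: "indep_sets G I"
  proof (rule indep_setsI)
    fix i assume i: "i \<in> I"
    show "G i \<subseteq> events"
    proof
      fix A assume "A \<in> G i"
      from GE[OF this] obtain p where p: "fst p \<in> sets (MA i)" "snd p \<in> sets (MB i)"
        and "A = X i -` fst p \<inter> Y i -` snd p \<inter> space M" by (elim exE conjE)
      then have A: "A = (X i -` fst p \<inter> space M) \<inter> (Y i -` snd p \<inter> space M)" by auto
      show "A \<in> events"
        unfolding A using i p by (intro sets.Int measurable_sets[of _ M "MA i"] measurable_sets[of _ M "MB i"]) auto
    qed
  next
    fix A J assume J: "J \<noteq> {}" "J \<subseteq> I" "finite J" and A: "\<forall>j\<in>J. A j \<in> G j"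
    then have "\<forall>j\<in>J. \<exists>p. fst p \<in> sets (MA j) \<and> snd p \<in> sets (MB j)
        \<and> A j = X j -` fst p \<inter> Y j -` snd p \<inter> space M"
      using GE by simp
    from bchoice[OF this] obtain p where p: "\<forall>j\<in>J. fst (p j) \<in> sets (MA j) \<and> snd (p j) \<in> sets (MB j)
        \<and> A j = X j -` fst (p j) \<inter> Y j -` snd (p j) \<inter> space M" ..
    define a b where "a j = fst (p j)" and "b j = snd (p j)" for j
    have a: "a j \<in> sets (MA j)" and b: "b j \<in> sets (MB j)"
      and Aj: "A j = X j -` a j \<inter> Y j -` b j \<inter> space M" if "j \<in> J" for j
      using p that by (simp_all add: a_def b_def)
    have Xa: "prob (\<Inter>j\<in>J. X j -` a j \<inter> space M) = (\<Prod>j\<in>J. prob (X j -` a j \<inter> space M))"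
      by (rule indep_varsD[OF X]) (use J a in auto)
    have Yb: "prob (\<Inter>j\<in>J. Y j -` b j \<inter> space M) = (\<Prod>j\<in>J. prob (Y j -` b j \<inter> space M))"
      by (rule indep_varsD[OF Y]) (use J b in auto)
    have 2: "prob ((\<lambda>x. (\<lambda>i\<in>I. X i x, \<lambda>i\<in>I. Y i x)) -` (C \<times> D) \<inter> space M)
        = prob ((\<lambda>x. \<lambda>i\<in>I. X i x) -` C \<inter> space M) * prob ((\<lambda>x. \<lambda>i\<in>I. Y i x) -` D \<inter> space M)"
      if "C \<in> sets (PiM I MA)" "D \<in> sets (PiM I MB)" for C D
      by (rule indep_varD[OF XY that])
    have vX: "(\<lambda>x. \<lambda>i\<in>I. X i x) -` prod_emb I MA J' (Pi\<^sub>E J' a) \<inter> space M = (\<Inter>j\<in>J'. X j -` a j \<inter> space M)"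
      if J': "J' \<noteq> {}" "J' \<subseteq> J" for J'
    proof -
      have "(\<lambda>i\<in>I. X i x) \<in> prod_emb I MA J' (Pi\<^sub>E J' a) \<longleftrightarrow> (\<forall>j\<in>J'. X j x \<in> a j)" if "x \<in> space M" for x
      proof -
        have "restrict (\<lambda>i\<in>I. X i x) J' = (\<lambda>i\<in>J'. X i x)"
          using J J' by (auto simp: restrict_def fun_eq_iff)
        moreover have "\<forall>i\<in>I. X i x \<in> space (MA i)"
          using that measurable_space[of "X _" M "MA _"] by simp
        ultimately show ?thesis
          by (auto simp: prod_emb_iff PiE_iff)
      qed
      then show ?thesis using J' by auto
    qed
    have vY: "(\<lambda>x. \<lambda>i\<in>I. Y i x) -` prod_emb I MB J' (Pi\<^sub>E J' b) \<inter> space M = (\<Inter>j\<in>J'. Y j -` b j \<inter> space M)"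
      if J': "J' \<noteq> {}" "J' \<subseteq> J" for J'
    proof -
      have "(\<lambda>i\<in>I. Y i x) \<in> prod_emb I MB J' (Pi\<^sub>E J' b) \<longleftrightarrow> (\<forall>j\<in>J'. Y j x \<in> b j)" if "x \<in> space M" for x
      proof -
        have "restrict (\<lambda>i\<in>I. Y i x) J' = (\<lambda>i\<in>J'. Y i x)"
          using J J' by (auto simp: restrict_def fun_eq_iff)
        moreover have "\<forall>i\<in>I. Y i x \<in> space (MB i)"
          using that measurable_space[of "Y _" M "MB _"] by simp
        ultimately show ?thesis
          by (auto simp: prod_emb_iff PiE_iff)
      qed
      then show ?thesis using J' by auto
    qed
    \<comment> \<open>Needed for J' = J, where it splits the joint event, and for singletons, where
      it splits each \<open>prob (A j)\<close>.\<close>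
    have *: "prob (\<Inter>j\<in>J'. A j) = prob (\<Inter>j\<in>J'. X j -` a j \<inter> space M) * prob (\<Inter>j\<in>J'. Y j -` b j \<inter> space M)"
      if J': "J' \<noteq> {}" "J' \<subseteq> J" for J'
    proof -
      let ?a = "prod_emb I MA J' (Pi\<^sub>E J' a)" and ?b = "prod_emb I MB J' (Pi\<^sub>E J' b)"
      have "(\<Inter>j\<in>J'. A j) = (\<Inter>j\<in>J'. X j -` a j \<inter> Y j -` b j \<inter> space M)"
        using Aj J' by (intro INF_cong) auto
      also have "\<dots> = (\<Inter>j\<in>J'. X j -` a j \<inter> space M) \<inter> (\<Inter>j\<in>J'. Y j -` b j \<inter> space M)"
        using J' by auto
      also have "\<dots> = (\<lambda>x. (\<lambda>i\<in>I. X i x, \<lambda>i\<in>I. Y i x)) -` (?a \<times> ?b) \<inter> space M"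
        by (subst vX[OF J', symmetric], subst vY[OF J', symmetric]) auto
      also have "prob \<dots> = prob ((\<lambda>x. \<lambda>i\<in>I. X i x) -` ?a \<inter> space M) * prob ((\<lambda>x. \<lambda>i\<in>I. Y i x) -` ?b \<inter> space M)"
        using a b J J' finite_subset[OF J'(2)] by (intro 2 sets_PiM_I) auto
      finally show ?thesis by (simp only: vX[OF J'] vY[OF J'])
    qed
    have "prob (A j) = prob (X j -` a j \<inter> space M) * prob (Y j -` b j \<inter> space M)" if "j \<in> J" for j
      using *[of "{j}"] that by simp
    then have "(\<Prod>j\<in>J. prob (A j)) = (\<Prod>j\<in>J. prob (X j -` a j \<inter> space M)) * (\<Prod>j\<in>J. prob (Y j -` b j \<inter> space M))"
      by (simp add: prod.distrib)
    also have "\<dots> = prob (\<Inter>j\<in>J. A j)"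
      unfolding *[OF J(1) subset_refl] Xa Yb ..
    finally show "prob (\<Inter>j\<in>J. A j) = (\<Prod>j\<in>J. prob (A j))" ..
  qed
  have "indep_sets (\<lambda>i. sigma_sets (space M) (G i)) I"
  proof (rule indep_sets_sigma[OF G])
    fix i assume "i \<in> I"
    show "Int_stable (G i)"
    proof (rule Int_stableI)
      fix A B assume "A \<in> G i" "B \<in> G i"
      from this[THEN GE] obtain p q where p: "fst p \<in> sets (MA i)" "snd p \<in> sets (MB i)"
        and q: "fst q \<in> sets (MA i)" "snd q \<in> sets (MB i)"
        and AB: "A = X i -` fst p \<inter> Y i -` snd p \<inter> space M" "B = X i -` fst q \<inter> Y i -` snd q \<inter> space M"
        by (elim exE conjE)
      have "A \<inter> B = X i -` (fst p \<inter> fst q) \<inter> Y i -` (snd p \<inter> snd q) \<inter> space M"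
        unfolding AB by auto
      also have "\<dots> \<in> G i"
        using p q by (intro GI sets.Int)
      finally show "A \<inter> B \<in> G i" .
    qed
  qed
  moreover have "sigma_sets (space M) (G i)
      = {(\<lambda>\<omega>. (X i \<omega>, Y i \<omega>)) -` A \<inter> space M | A. A \<in> sets (MA i \<Otimes>\<^sub>M MB i)}" if i: "i \<in> I" for i
  proof -
    have "{(\<lambda>\<omega>. (X i \<omega>, Y i \<omega>)) -` A \<inter> space M | A. A \<in> {a \<times> b | a b. a \<in> sets (MA i) \<and> b \<in> sets (MB i)}}
        = G i" (is "?L = _")
    proof
      show "?L \<subseteq> G i"
      proof
        fix A assume "A \<in> ?L"
        then obtain a b where ab: "a \<in> sets (MA i)" "b \<in> sets (MB i)"
          and A: "A = (\<lambda>\<omega>. (X i \<omega>, Y i \<omega>)) -` (a \<times> b) \<inter> space M"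
          by (elim CollectE exE conjE) simp
        have "A = X i -` a \<inter> Y i -` b \<inter> space M"
          unfolding A by auto
        then show "A \<in> G i" by (rule ssubst) (rule GI[OF ab])
      qed
    next
      show "G i \<subseteq> ?L"
      proof
        fix A assume "A \<in> G i"
        from GE[OF this] obtain p where p: "fst p \<in> sets (MA i)" "snd p \<in> sets (MB i)"
          and A: "A = X i -` fst p \<inter> Y i -` snd p \<inter> space M" by (elim exE conjE)
        have "A = (\<lambda>\<omega>. (X i \<omega>, Y i \<omega>)) -` (fst p \<times> snd p) \<inter> space M"
          unfolding A by auto
        with p show "A \<in> ?L" by (intro CollectI exI[of _ "fst p \<times> snd p"] exI[of _ "fst p"] exI[of _ "snd p"] conjI) simp_all
      qed
    qed
    moreover have "(\<lambda>\<omega>. (X i \<omega>, Y i \<omega>)) \<in> space M \<rightarrow> space (MA i) \<times> space (MB i)"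
      using i measurable_space[of "X i" M "MA i"] measurable_space[of "Y i" M "MB i"] by simp
    ultimately show ?thesis
      unfolding sets_pair_measure by (subst sigma_sets_vimage_commute) simp_all
  qed
  moreover have "\<forall>i\<in>I. (\<lambda>\<omega>. (X i \<omega>, Y i \<omega>)) \<in> M \<rightarrow>\<^sub>M MA i \<Otimes>\<^sub>M MB i"
    by simp
  ultimately show ?thesis
    unfolding indep_vars_def2 by (simp cong: indep_sets_cong)
qed

subsection \<open>The observation is independent of the orthogonal noise\<close>

locale wiener_pair = prob_space M + B: standard_wiener_process M B + N: standard_wiener_process M N
  for M :: "'a measure" and B N :: "real \<Rightarrow> 'a \<Rightarrow> real" +
  assumes indep: "indep_processes M B N"

text \<open>The times are left general because three grids occur: the sorted times of a cylinder
  event, the single step from 0 to u, and the uniform grid of the walk.\<close>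

locale sampled_wiener_pair = wiener_pair +
  fixes t :: "nat \<Rightarrow> real" and k :: nat
  assumes t_0: "0 \<le> t 0" and t_less: "\<And>i. i < k \<Longrightarrow> t i < t (Suc i)"
begin

definition D :: "nat \<Rightarrow> 'a \<Rightarrow> real" where
  "D i \<omega> = B (t (Suc i)) \<omega> - B (t i) \<omega>"

definition E :: "nat \<Rightarrow> 'a \<Rightarrow> real" where
  "E i \<omega> = N (t (Suc i)) \<omega> - N (t i) \<omega>"

lemma t_nonneg: "i \<le> k \<Longrightarrow> 0 \<le> t i"
proof (induction i)
  case (Suc i)
  then show ?case using t_less[of i] by simp
qed (rule t_0)

lemma rv_D: "i < k \<Longrightarrow> random_variable borel (D i)"
  unfolding D_def
  by (intro borel_measurable_diff B.random_variable_at t_nonneg) auto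

lemma rv_E: "i < k \<Longrightarrow> random_variable borel (E i)"
  unfolding E_def
  by (intro borel_measurable_diff N.random_variable_at t_nonneg) auto

lemma normal_D: "i < k \<Longrightarrow> distributed M lborel (D i) (normal_density 0 (sqrt (t (Suc i) - t i)))"
  unfolding D_def by (intro B.normal_increments t_nonneg t_less) auto

lemma normal_E: "i < k \<Longrightarrow> distributed M lborel (E i) (normal_density 0 (sqrt (t (Suc i) - t i)))"
  unfolding E_def by (intro N.normal_increments t_nonneg t_less) auto

lemma indep_increment_vectors:
  "indep_var (PiM {..<k} (\<lambda>_. borel)) (\<lambda>\<omega>. \<lambda>i\<in>{..<k}. D i \<omega>) (PiM {..<k} (\<lambda>_. borel)) (\<lambda>\<omega>. \<lambda>i\<in>{..<k}. E i \<omega>)"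
proof -
  let ?inc = "\<lambda>w :: real \<Rightarrow> real. \<lambda>i\<in>{..<k}. w (t (Suc i)) - w (t i)"
  have "(\<lambda>w. w (t i)) \<in> borel_measurable path_space" if "i \<le> k" for i
    using t_nonneg[OF that] by (intro measurable_component_singleton) simp
  then have inc: "?inc \<in> path_space \<rightarrow>\<^sub>M PiM {..<k} (\<lambda>_. borel)"
    by (intro measurable_restrict borel_measurable_diff) auto
  have "?inc \<circ> sample_path B = (\<lambda>\<omega>. \<lambda>i\<in>{..<k}. D i \<omega>)" "?inc \<circ> sample_path N = (\<lambda>\<omega>. \<lambda>i\<in>{..<k}. E i \<omega>)"
    using t_nonneg by (auto simp: fun_eq_iff sample_path_def D_def E_def)
  with indep_var_compose[OF indep[unfolded indep_processes_def] inc inc] show ?thesis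
    by simp
qed

lemma indep_pairs: "indep_vars (\<lambda>_. borel \<Otimes>\<^sub>M borel) (\<lambda>i \<omega>. (D i \<omega>, E i \<omega>)) {..<k}"
proof (rule indep_vars_Pair)
  show "indep_vars (\<lambda>_. borel) D {..<k}"
    unfolding D_def[abs_def] by (rule B.indep_increments[OF t_0 t_less])
  show "indep_vars (\<lambda>_. borel) E {..<k}"
    unfolding E_def[abs_def] by (rule N.indep_increments[OF t_0 t_less])
qed (simp_all add: indep_increment_vectors)

lemma indep_D_E: "i < k \<Longrightarrow> indep_var borel (D i) borel (E i)"
  using indep_var_compose[OF indep_increment_vectors, of "\<lambda>x. x i" borel "\<lambda>x. x i" borel]
  by (simp add: comp_def)

text \<open>One reflection serves all increments although their variances differ: a pair of
  independent centred normals of equal variance is invariant at every scale, and independence over i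
  carries this to the joint law.\<close>

lemma distr_increments_reflection:
  assumes d: "0 < d" and cd: "c\<^sup>2 + d\<^sup>2 = 1"
  shows "distr M (PiM {..<k} (\<lambda>_. borel \<Otimes>\<^sub>M borel))
        (\<lambda>\<omega>. \<lambda>i\<in>{..<k}. (c * D i \<omega> + d * E i \<omega>, d * D i \<omega> - c * E i \<omega>))
      = distr M (PiM {..<k} (\<lambda>_. borel \<Otimes>\<^sub>M borel)) (\<lambda>\<omega>. \<lambda>i\<in>{..<k}. (D i \<omega>, E i \<omega>))"
proof (cases "k = 0")
  case False
  have R: "(\<lambda>(x, y). (c * x + d * y, d * x - c * y)) \<in> borel \<Otimes>\<^sub>M borel \<rightarrow>\<^sub>M borel \<Otimes>\<^sub>M (borel :: real measure)"
    by measurable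
  have *: "indep_vars (\<lambda>_. borel \<Otimes>\<^sub>M borel) (\<lambda>i \<omega>. (c * D i \<omega> + d * E i \<omega>, d * D i \<omega> - c * E i \<omega>)) {..<k}"
    using indep_vars_compose2[OF indep_pairs R] by simp
  have [measurable]: "D i \<in> borel_measurable M" "E i \<in> borel_measurable M" if "i \<in> {..<k}" for i
    using that rv_D rv_E by auto
  have R: "distr M (borel \<Otimes>\<^sub>M borel) (\<lambda>\<omega>. (c * D i \<omega> + d * E i \<omega>, d * D i \<omega> - c * E i \<omega>))
      = distr M (borel \<Otimes>\<^sub>M borel) (\<lambda>\<omega>. (D i \<omega>, E i \<omega>))" if "i < k" for i
    by (rule distr_normal_reflection[OF indep_D_E[OF that] _ normal_D[OF that] normal_E[OF that] d cd])
      (simp add: t_less[OF that])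
  have "distr M (PiM {..<k} (\<lambda>_. borel \<Otimes>\<^sub>M borel))
        (\<lambda>\<omega>. \<lambda>i\<in>{..<k}. (c * D i \<omega> + d * E i \<omega>, d * D i \<omega> - c * E i \<omega>))
      = (\<Pi>\<^sub>M i\<in>{..<k}. distr M (borel \<Otimes>\<^sub>M borel) (\<lambda>\<omega>. (c * D i \<omega> + d * E i \<omega>, d * D i \<omega> - c * E i \<omega>)))"
    using False * by (intro indep_vars_iff_distr_eq_PiM'[THEN iffD1]) auto
  also have "\<dots> = (\<Pi>\<^sub>M i\<in>{..<k}. distr M (borel \<Otimes>\<^sub>M borel) (\<lambda>\<omega>. (D i \<omega>, E i \<omega>)))"
    by (rule PiM_cong[OF refl], rule R) simp
  also have "\<dots> = distr M (PiM {..<k} (\<lambda>_. borel \<Otimes>\<^sub>M borel)) (\<lambda>\<omega>. \<lambda>i\<in>{..<k}. (D i \<omega>, E i \<omega>))"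
    using False indep_pairs by (intro indep_vars_iff_distr_eq_PiM'[THEN iffD1, symmetric]) auto
  finally show ?thesis .
qed (simp add: restrict_def)

text \<open>The reflection fixes each D + e E and negates each e D - E, so the expectation equals
  its own negative. This covers unbounded h too, the integral having the default value 0 in the
  nonintegrable case.\<close>

lemma expectation_observation_times_sgn:
  fixes h :: "(nat \<Rightarrow> real) \<Rightarrow> real"
  assumes h [measurable]: "h \<in> borel_measurable (PiM {..<k} (\<lambda>_. borel))"
    and e: "0 < e" and m: "m \<le> k"
  shows "expectation (\<lambda>\<omega>. h (\<lambda>i\<in>{..<k}. D i \<omega> + e * E i \<omega>) * sgn (\<Sum>i<m. e * D i \<omega> - E i \<omega>)) = 0"
proof -
  \<comment> \<open>The reflection 2 v v^T - 1, with v the unit vector along (1, e), has rows (c, d)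
    and (d, -c); \<open>c1\<close> and \<open>c2\<close> below say that it fixes (1, e).\<close>
  define c d where "c = (1 - e\<^sup>2) / (1 + e\<^sup>2)" and "d = 2 * e / (1 + e\<^sup>2)"
  have pos: "1 + e\<^sup>2 > 0" by (simp add: add_pos_nonneg)
  then have d: "0 < d" using e by (simp add: d_def)
  have cd: "c\<^sup>2 + d\<^sup>2 = 1"
  proof -
    have "(1 - e\<^sup>2)\<^sup>2 + (2 * e)\<^sup>2 = (1 + e\<^sup>2)\<^sup>2" by algebra
    then show ?thesis using pos
      by (simp add: c_def d_def power_divide flip: add_divide_distrib)
  qed
  have c: "c * (1 + e\<^sup>2) = 1 - e\<^sup>2" and d': "d * (1 + e\<^sup>2) = 2 * e"
    using pos by (simp_all add: c_def d_def)
  have "(c + e * d) * (1 + e\<^sup>2) = 1 * (1 + e\<^sup>2)"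
    using c d' by algebra
  then have c1: "c + e * d = 1" using pos by simp
  have "(d - e * c) * (1 + e\<^sup>2) = e * (1 + e\<^sup>2)"
    using c d' by algebra
  then have c2: "d - e * c = e" using pos by simp
  define G where "G p = h (\<lambda>i\<in>{..<k}. fst (p i) + e * snd (p i)) * sgn (\<Sum>i<m. e * fst (p i) - snd (p i))"
    for p :: "nat \<Rightarrow> real \<times> real"
  let ?P = "PiM {..<k} (\<lambda>_. borel \<Otimes>\<^sub>M borel) :: (nat \<Rightarrow> real \<times> real) measure"
  have [measurable]: "D i \<in> borel_measurable M" "E i \<in> borel_measurable M" if "i \<in> {..<k}" for i
    using that rv_D rv_E by auto
  have [measurable]: "(\<lambda>p. p i) \<in> ?P \<rightarrow>\<^sub>M borel \<Otimes>\<^sub>M borel" if "i \<in> {..<k}" for i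
    using that by simp
  have fst_snd: "(\<lambda>p. fst (p i)) \<in> borel_measurable ?P" "(\<lambda>p. snd (p i)) \<in> borel_measurable ?P" if "i \<in> {..<k}" for i
    using that by measurable
  then have "(\<lambda>p. \<Sum>i<m. e * fst (p i) - snd (p i)) \<in> borel_measurable ?P"
    using m by (intro borel_measurable_sum borel_measurable_diff borel_measurable_times) auto
  moreover have "(\<lambda>p. \<lambda>i\<in>{..<k}. fst (p i) + e * snd (p i)) \<in> ?P \<rightarrow>\<^sub>M PiM {..<k} (\<lambda>_. borel)"
    using fst_snd by (intro measurable_restrict borel_measurable_add borel_measurable_times) auto
  ultimately have G: "G \<in> borel_measurable ?P"
    unfolding G_def by measurable
  let ?p = "\<lambda>\<omega>. \<lambda>i\<in>{..<k}. (D i \<omega>, E i \<omega>)"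
  let ?q = "\<lambda>\<omega>. \<lambda>i\<in>{..<k}. (c * D i \<omega> + d * E i \<omega>, d * D i \<omega> - c * E i \<omega>)"
  have Gp: "G (?p \<omega>) = h (\<lambda>i\<in>{..<k}. D i \<omega> + e * E i \<omega>) * sgn (\<Sum>i<m. e * D i \<omega> - E i \<omega>)" for \<omega>
  proof -
    have "(\<lambda>i\<in>{..<k}. fst (?p \<omega> i) + e * snd (?p \<omega> i)) = (\<lambda>i\<in>{..<k}. D i \<omega> + e * E i \<omega>)"
      by (rule restrict_ext) simp
    moreover have "(\<Sum>i<m. e * fst (?p \<omega> i) - snd (?p \<omega> i)) = (\<Sum>i<m. e * D i \<omega> - E i \<omega>)"
      using m by (intro sum.cong) auto
    ultimately show ?thesis unfolding G_def by presburger
  qed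
  have Gq: "G (?q \<omega>) = - G (?p \<omega>)" for \<omega>
  proof -
    have "c * x + d * y + e * (d * x - c * y) = x + e * y" for x y
    proof -
      have "c * x + d * y + e * (d * x - c * y) = (c + e * d) * x + (d - e * c) * y" by algebra
      then show ?thesis by (simp add: c1 c2)
    qed
    then have "(\<lambda>i\<in>{..<k}. fst (?q \<omega> i) + e * snd (?q \<omega> i)) = (\<lambda>i\<in>{..<k}. D i \<omega> + e * E i \<omega>)"
      by (intro restrict_ext) simp
    moreover have "e * (c * x + d * y) - (d * x - c * y) = - (e * x - y)" for x y
    proof -
      have "e * (c * x + d * y) - (d * x - c * y) = (c + e * d) * y - (d - e * c) * x" by algebra
      then show ?thesis by (simp add: c1 c2)
    qed
    then have "(\<Sum>i<m. e * fst (?q \<omega> i) - snd (?q \<omega> i)) = - (\<Sum>i<m. e * D i \<omega> - E i \<omega>)"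
      unfolding sum_negf[symmetric] using m by (intro sum.cong) auto
    ultimately show ?thesis unfolding Gp unfolding G_def by (simp add: sgn_minus)
  qed
  have "expectation (\<lambda>\<omega>. G (?p \<omega>)) = integral\<^sup>L (distr M ?P ?p) G"
    by (rule integral_distr[symmetric, OF _ G]) simp
  also have "\<dots> = integral\<^sup>L (distr M ?P ?q) G"
    by (subst distr_increments_reflection[OF d cd]) simp
  also have "\<dots> = expectation (\<lambda>\<omega>. G (?q \<omega>))"
    by (rule integral_distr[OF _ G]) measurable
  also have "\<dots> = - expectation (\<lambda>\<omega>. G (?p \<omega>))"
    by (simp only: Gq integral_minus)
  finally show ?thesis
    unfolding Gp by simp
qed

end

section \<open>From finitely many increments to the whole observed path\<close>

context wiener_pair
begin

text \<open>Initial values are subtracted so that the process is built from increments and drift,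
  and starts at 0 at every outcome, not only almost surely.\<close>

definition obs :: "real \<Rightarrow> real \<Rightarrow> real \<Rightarrow> 'a \<Rightarrow> real" where
  "obs e s u \<omega> = (B u \<omega> - B 0 \<omega>) + e * (N u \<omega> - N 0 \<omega>) + s * u"

text \<open>The multiple of the noise that reflection about \<open>B + e N\<close> negates.\<close>

definition orth :: "real \<Rightarrow> real \<Rightarrow> 'a \<Rightarrow> real" where
  "orth e u \<omega> = e * (B u \<omega> - B 0 \<omega>) - (N u \<omega> - N 0 \<omega>)"

lemma borel_measurable_B [measurable (raw)]: "0 \<le> u \<Longrightarrow> B u \<in> borel_measurable M"
  by (rule B.random_variable_at)

lemma borel_measurable_N [measurable (raw)]: "0 \<le> u \<Longrightarrow> N u \<in> borel_measurable M"
  by (rule N.random_variable_at)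

lemma borel_measurable_obs [measurable (raw)]: "0 \<le> u \<Longrightarrow> obs e s u \<in> borel_measurable M"
  unfolding obs_def[abs_def] by measurable

lemma borel_measurable_orth [measurable (raw)]: "0 \<le> u \<Longrightarrow> orth e u \<in> borel_measurable M"
  unfolding orth_def[abs_def] by measurable

lemma measurable_sample_path_obs [measurable]: "sample_path (obs e s) \<in> M \<rightarrow>\<^sub>M path_space"
  unfolding sample_path_def[abs_def] by (intro measurable_restrict borel_measurable_obs) simp

text \<open>A cylinder event of the observation is a function of the increments of B + e N on a grid
  containing its times. With 0 and u on the same grid, \<open>orth e u\<close> is a partial sum of
  the orthogonal increments.\<close>

lemma expectation_cylinder_times_sgn:
  assumes e: "0 < e" and u: "0 \<le> u" and J: "finite J" "J \<subseteq> {0..}"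
    and A: "\<And>j. j \<in> J \<Longrightarrow> A j \<in> sets borel"
  shows "expectation (\<lambda>\<omega>. (\<Prod>j\<in>J. indicator (A j) (obs e s j \<omega>)) * sgn (orth e u \<omega>)) = 0"
proof -
  define xs where "xs = sorted_list_of_set (insert 0 (insert u J))"
  define k where "k = length xs - 1"
  define t where "t i = xs ! i" for i
  have set_xs: "set xs = insert 0 (insert u J)"
    unfolding xs_def using J by (intro set_sorted_list_of_set) simp
  have sorted: "sorted_wrt (<) xs"
    unfolding xs_def by (rule strict_sorted_list_of_set)
  from set_xs have len: "length xs = Suc k" by (cases xs) (auto simp: k_def)
  have less: "t i < t (Suc i)" if "i < k" for i
    unfolding t_def using that len by (intro sorted_wrt_nth_less[OF sorted]) simp_all
  have ex: "\<exists>i\<le>k. t i = x" if "x \<in> insert 0 (insert u J)" for x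
    using that unfolding set_xs[symmetric] in_set_conv_nth len by (auto simp: t_def less_Suc_eq_le)
  have t0: "t 0 = 0"
  proof -
    have le: "t 0 \<le> t i" if "i \<le> k" for i using that
    proof (induction i)
      case (Suc i)
      then show ?case using less[of i] by simp
    qed simp
    obtain i where "i \<le> k" "t i = 0" using ex[of 0] by auto
    with le have "t 0 \<le> 0" by fastforce
    moreover have "t 0 \<in> insert 0 (insert u J)"
      unfolding set_xs[symmetric] t_def using len by simp
    then have "0 \<le> t 0" using J u by auto
    ultimately show ?thesis by simp
  qed
  interpret sampled_wiener_pair M B N t k
    by unfold_locales (use t0 less in auto)
  have sumD: "(\<Sum>i<l. D i \<omega>) = B (t l) \<omega> - B 0 \<omega>" and sumE: "(\<Sum>i<l. E i \<omega>) = N (t l) \<omega> - N 0 \<omega>" for l \<omega>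
    using sum_lessThan_telescope[of "\<lambda>i. B (t i) \<omega>" l] sum_lessThan_telescope[of "\<lambda>i. N (t i) \<omega>" l]
    by (simp_all add: D_def E_def t0)
  obtain m where m: "m \<le> k" "t m = u" using ex[of u] by auto
  have "\<exists>f. \<forall>j\<in>J. f j \<le> k \<and> t (f j) = j"
    using ex by (intro bchoice) auto
  then obtain f where f: "\<And>j. j \<in> J \<Longrightarrow> f j \<le> k" "\<And>j. j \<in> J \<Longrightarrow> t (f j) = j" by auto
  \<comment> \<open>Rebuilds the observed values at the times in J from the driftless increments v,
    adding the deterministic drift back.\<close>
  define h where "h v = (\<Prod>j\<in>J. indicator (A j) ((\<Sum>i<f j. v i) + s * j) :: real)" for v :: "nat \<Rightarrow> real"
  let ?P = "PiM {..<k} (\<lambda>_. borel) :: (nat \<Rightarrow> real) measure"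
  have h: "h \<in> borel_measurable ?P"
    unfolding h_def[abs_def]
  proof (intro borel_measurable_prod)
    fix j assume j: "j \<in> J"
    have "(\<lambda>v. (\<Sum>i<f j. v i) + s * j) \<in> borel_measurable ?P"
      using f(1)[OF j] by (intro borel_measurable_add borel_measurable_sum) auto
    from measurable_compose[OF this borel_measurable_indicator[OF A[OF j]]]
    show "(\<lambda>v. indicator (A j) ((\<Sum>i<f j. v i) + s * j) :: real) \<in> borel_measurable ?P" .
  qed
  have "h (\<lambda>i\<in>{..<k}. D i \<omega> + e * E i \<omega>) = (\<Prod>j\<in>J. indicator (A j) (obs e s j \<omega>))" for \<omega>
    unfolding h_def
  proof (rule prod.cong[OF refl])
    fix j assume j: "j \<in> J"
    have "(\<Sum>i<f j. (\<lambda>i\<in>{..<k}. D i \<omega> + e * E i \<omega>) i) = (\<Sum>i<f j. D i \<omega> + e * E i \<omega>)"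
      using f(1)[OF j] by (intro sum.cong) auto
    also have "\<dots> = (\<Sum>i<f j. D i \<omega>) + e * (\<Sum>i<f j. E i \<omega>)"
      by (simp add: sum.distrib sum_distrib_left)
    finally show "indicator (A j) ((\<Sum>i<f j. (\<lambda>i\<in>{..<k}. D i \<omega> + e * E i \<omega>) i) + s * j) = indicator (A j) (obs e s j \<omega>)"
      using f(2)[OF j] by (simp add: sumD sumE obs_def)
  qed
  moreover have "(\<Sum>i<m. e * D i \<omega> - E i \<omega>) = orth e u \<omega>" for \<omega>
    by (simp add: sum_subtractf sumE orth_def m(2) flip: sum_distrib_left) (simp add: sumD m(2))
  ultimately show ?thesis
    using expectation_observation_times_sgn[OF h e m(1)] by simp
qed

lemma expectation_sgn_orth: "0 < e \<Longrightarrow> 0 \<le> u \<Longrightarrow> expectation (\<lambda>\<omega>. sgn (orth e u \<omega>)) = 0"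
  using expectation_cylinder_times_sgn[of e u "{}"] by simp

text \<open>The laws of the observation on the events V > 0 and V < 0 agree on cylinders, hence as
  finite measures on path space. Outcomes with V = 0 drop out since sgn 0 = 0.\<close>

lemma expectation_path_times_sgn:
  fixes f :: "(real \<Rightarrow> real) \<Rightarrow> real"
  assumes f [measurable]: "f \<in> borel_measurable path_space" and bound: "\<And>w. \<bar>f w\<bar> \<le> b"
    and e: "0 < e" and u: "0 \<le> u"
  shows "expectation (\<lambda>\<omega>. f (sample_path (obs e s) \<omega>) * sgn (orth e u \<omega>)) = 0"
proof -
  note [measurable] = borel_measurable_orth[OF u]
  let ?Y = "sample_path (obs e s)" and ?V = "orth e u"
  \<comment> \<open>The law of the observed path restricted to the event that V lies in C; its total
    mass may be below 1.\<close>
  define P where "P C = distr (density M (indicator {\<omega>\<in>space M. ?V \<omega> \<in> C})) path_space ?Y" for C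
  have emP: "emeasure (P C) S = emeasure M {\<omega>\<in>space M. ?Y \<omega> \<in> S \<and> ?V \<omega> \<in> C}"
    if [measurable]: "S \<in> sets path_space" "C \<in> sets borel" for S C
  proof -
    have "emeasure (P C) S = (\<integral>\<^sup>+\<omega>. indicator {\<omega>\<in>space M. ?V \<omega> \<in> C} \<omega> * indicator (?Y -` S \<inter> space M) \<omega> \<partial>M)"
      unfolding P_def by (subst emeasure_distr) (simp_all add: emeasure_density)
    also have "\<dots> = (\<integral>\<^sup>+\<omega>. indicator {\<omega>\<in>space M. ?Y \<omega> \<in> S \<and> ?V \<omega> \<in> C} \<omega> \<partial>M)"
      by (intro nn_integral_cong) (auto split: split_indicator)
    finally show ?thesis by simp
  qed
  have fin: "finite_measure (P C)" if "C \<in> sets borel" for C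
  proof
    have "emeasure (P C) (space (P C)) = emeasure M {\<omega>\<in>space M. ?Y \<omega> \<in> space path_space \<and> ?V \<omega> \<in> C}"
      using emP[OF sets.top that] by (simp add: P_def)
    then show "emeasure (P C) (space (P C)) \<noteq> \<infinity>" by simp
  qed
  have "P {0<..} = P {..<0}"
  proof (rule measure_eqI_PiM_infinite)
    show "sets (P {0<..}) = sets path_space" "sets (P {..<0}) = sets path_space"
      by (simp_all add: P_def)
    show "finite_measure (P {0<..})" by (rule fin) simp
  next
    fix A :: "real \<Rightarrow> real set" and J
    assume J: "finite J" "J \<subseteq> {0..}" and A: "\<And>i. i \<in> J \<Longrightarrow> A i \<in> sets borel"
    let ?S = "prod_emb {0..} (\<lambda>_. borel) J (Pi\<^sub>E J A)"
    have S [measurable]: "?S \<in> sets path_space"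
      using J A by (intro sets_PiM_I) auto
    have S_iff: "?Y \<omega> \<in> ?S \<longleftrightarrow> (\<forall>j\<in>J. obs e s j \<omega> \<in> A j)" for \<omega>
    proof -
      have "restrict (?Y \<omega>) J = (\<lambda>j\<in>J. obs e s j \<omega>)"
        using J by (auto simp: restrict_def fun_eq_iff sample_path_def)
      then show ?thesis
        by (auto simp: prod_emb_iff PiE_iff sample_path_def)
    qed
    define pp pn where "pp = prob {\<omega>\<in>space M. ?Y \<omega> \<in> ?S \<and> ?V \<omega> \<in> {0<..}}"
      and "pn = prob {\<omega>\<in>space M. ?Y \<omega> \<in> ?S \<and> ?V \<omega> \<in> {..<0}}"
    have "0 = expectation (\<lambda>\<omega>. (\<Prod>j\<in>J. indicator (A j) (obs e s j \<omega>)) * sgn (?V \<omega>))"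
      using expectation_cylinder_times_sgn[OF e u J A] by simp
    also have "\<dots> = expectation (\<lambda>\<omega>. indicator {\<omega>\<in>space M. ?Y \<omega> \<in> ?S \<and> ?V \<omega> \<in> {0<..}} \<omega>
        - indicator {\<omega>\<in>space M. ?Y \<omega> \<in> ?S \<and> ?V \<omega> \<in> {..<0}} \<omega>)"
    proof (intro Bochner_Integration.integral_cong refl)
      fix \<omega> assume \<omega>: "\<omega> \<in> space M"
      have "(\<Prod>j\<in>J. indicator (A j) (obs e s j \<omega>)) = (of_bool (\<forall>j\<in>J. obs e s j \<omega> \<in> A j) :: real)"
      proof (cases "\<forall>j\<in>J. obs e s j \<omega> \<in> A j")
        case False
        then show ?thesis using J by (auto simp: indicator_def)
      qed simp
      then show "(\<Prod>j\<in>J. indicator (A j) (obs e s j \<omega>)) * sgn (?V \<omega>) =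
          indicator {\<omega>\<in>space M. ?Y \<omega> \<in> ?S \<and> ?V \<omega> \<in> {0<..}} \<omega>
          - indicator {\<omega>\<in>space M. ?Y \<omega> \<in> ?S \<and> ?V \<omega> \<in> {..<0}} \<omega>"
        using \<omega> by (auto simp: S_iff indicator_def sgn_if)
    qed
    also have "\<dots> = pp - pn"
      unfolding pp_def pn_def by (subst Bochner_Integration.integral_diff) (simp_all add: emeasure_eq_measure)
    finally have "pp = pn" by simp
    then show "emeasure (P {0<..}) ?S = emeasure (P {..<0}) ?S"
      by (simp add: emP pp_def pn_def emeasure_eq_measure)
  qed
  have int: "integral\<^sup>L (P C) f = expectation (\<lambda>\<omega>. indicator {\<omega>\<in>space M. ?V \<omega> \<in> C} \<omega> * f (?Y \<omega>))"
    if [measurable]: "C \<in> sets borel" for C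
  proof -
    have "integral\<^sup>L (P C) f = (\<integral>\<omega>. f (?Y \<omega>) \<partial>density M (indicator {\<omega>\<in>space M. ?V \<omega> \<in> C}))"
      unfolding P_def by (rule integral_distr) simp_all
    also have "(indicator {\<omega>\<in>space M. ?V \<omega> \<in> C} :: 'a \<Rightarrow> ennreal) = (\<lambda>\<omega>. ennreal (indicator {\<omega>\<in>space M. ?V \<omega> \<in> C} \<omega>))"
      by (simp add: fun_eq_iff ennreal_indicator)
    finally show ?thesis by (subst (asm) integral_density) auto
  qed
  have integrable: "integrable M (\<lambda>\<omega>. indicator {\<omega>\<in>space M. ?V \<omega> \<in> C} \<omega> * f (?Y \<omega>))"
    if [measurable]: "C \<in> sets borel" for C
    by (rule integrable_const_bound[of _ b])
      (use bound order_trans[OF abs_ge_zero bound] in \<open>auto simp: abs_mult split: split_indicator\<close>)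
  have "expectation (\<lambda>\<omega>. f (?Y \<omega>) * sgn (?V \<omega>))
      = expectation (\<lambda>\<omega>. indicator {\<omega>\<in>space M. ?V \<omega> \<in> {0<..}} \<omega> * f (?Y \<omega>)
          - indicator {\<omega>\<in>space M. ?V \<omega> \<in> {..<0}} \<omega> * f (?Y \<omega>))"
    by (intro Bochner_Integration.integral_cong refl) (auto simp: sgn_if indicator_def)
  also have "\<dots> = integral\<^sup>L (P {0<..}) f - integral\<^sup>L (P {..<0}) f"
    by (subst Bochner_Integration.integral_diff[OF integrable integrable]) (simp_all add: int)
  finally show ?thesis
    using \<open>P {0<..} = P {..<0}\<close> by simp
qed

end

subsection \<open>Moments of Gaussian increments\<close>

context prob_space
begin

text \<open>The absolute moment enters the constants of both leading terms, the positive part bounds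
  the time lost before n, and the fourth moment controls the overshoot on the grid and the shortfall
  at the horizon.\<close>

lemma
  fixes X :: "'a \<Rightarrow> real"
  assumes X: "distributed M lborel X (normal_density 0 \<sigma>)" and \<sigma>: "0 < \<sigma>"
  shows integrable_normal: "integrable M X"
    and integrable_normal_power4: "integrable M (\<lambda>\<omega>. X \<omega> ^ 4)"
    and expectation_normal: "expectation X = 0"
    and expectation_normal_abs: "expectation (\<lambda>\<omega>. \<bar>X \<omega>\<bar>) = \<sigma> * sqrt (2 / pi)"
    and expectation_normal_power4: "expectation (\<lambda>\<omega>. X \<omega> ^ 4) = 3 * \<sigma> ^ 4"
    and expectation_normal_pos_part: "expectation (\<lambda>\<omega>. max 0 (X \<omega>)) = \<sigma> / sqrt (2 * pi)"
proof -
  show X_int: "integrable M X"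
    using integrable_normal_moment[OF \<sigma>, of 0 1] distributed_integrable[OF X, of "\<lambda>x. x"] by simp
  show "integrable M (\<lambda>\<omega>. X \<omega> ^ 4)"
    using integrable_normal_moment[OF \<sigma>, of 0 4] distributed_integrable[OF X, of "\<lambda>x. x ^ 4"] by simp
  show E: "expectation X = 0"
    by (rule normal_distributed_expectation[OF \<sigma> X])
  show E_abs: "expectation (\<lambda>\<omega>. \<bar>X \<omega>\<bar>) = \<sigma> * sqrt (2 / pi)"
    using integral_normal_moment_abs_odd[OF \<sigma>, of 0 0] distributed_integral[OF X, of "\<lambda>x. \<bar>x\<bar>"] by simp
  show "expectation (\<lambda>\<omega>. X \<omega> ^ 4) = 3 * \<sigma> ^ 4"
    using integral_normal_moment_even[OF \<sigma>, of 0 2] distributed_integral[OF X, of "\<lambda>x. x ^ 4"]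
    by (simp add: fact_numeral power_divide)
  have "(\<lambda>\<omega>. max 0 (X \<omega>)) = (\<lambda>\<omega>. (X \<omega> + \<bar>X \<omega>\<bar>) / 2)"
    by (auto simp: fun_eq_iff max_def)
  then have "expectation (\<lambda>\<omega>. max 0 (X \<omega>)) = (expectation X + expectation (\<lambda>\<omega>. \<bar>X \<omega>\<bar>)) / 2"
    using X_int by simp
  also have "\<dots> = \<sigma> / sqrt (2 * pi)"
    unfolding E E_abs by (simp add: real_sqrt_mult real_sqrt_divide field_simps)
  finally show "expectation (\<lambda>\<omega>. max 0 (X \<omega>)) = \<sigma> / sqrt (2 * pi)" .
qed

end

lemma (in standard_wiener_process)
  assumes "0 \<le> u" "u < v"
  shows integrable_increment: "integrable M (\<lambda>\<omega>. W v \<omega> - W u \<omega>)"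
    and integrable_increment_power4: "integrable M (\<lambda>\<omega>. (W v \<omega> - W u \<omega>) ^ 4)"
    and expectation_increment: "expectation (\<lambda>\<omega>. W v \<omega> - W u \<omega>) = 0"
    and expectation_increment_abs: "expectation (\<lambda>\<omega>. \<bar>W v \<omega> - W u \<omega>\<bar>) = sqrt (2 / pi * (v - u))"
    and expectation_increment_power4: "expectation (\<lambda>\<omega>. (W v \<omega> - W u \<omega>) ^ 4) = 3 * (v - u)\<^sup>2"
    and expectation_increment_pos_part:
      "expectation (\<lambda>\<omega>. max 0 (W v \<omega> - W u \<omega>)) = sqrt ((v - u) / (2 * pi))"
proof -
  note n = normal_increments[OF assms]
  have \<sigma>: "0 < sqrt (v - u)" using assms by simp
  have 4: "sqrt (v - u) ^ 4 = (v - u)\<^sup>2"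
    using assms power_mult[of "sqrt (v - u)" 2 2] by simp
  show "integrable M (\<lambda>\<omega>. W v \<omega> - W u \<omega>)" "integrable M (\<lambda>\<omega>. (W v \<omega> - W u \<omega>) ^ 4)"
    "expectation (\<lambda>\<omega>. W v \<omega> - W u \<omega>) = 0"
    "expectation (\<lambda>\<omega>. \<bar>W v \<omega> - W u \<omega>\<bar>) = sqrt (2 / pi * (v - u))"
    "expectation (\<lambda>\<omega>. (W v \<omega> - W u \<omega>) ^ 4) = 3 * (v - u)\<^sup>2"
    "expectation (\<lambda>\<omega>. max 0 (W v \<omega> - W u \<omega>)) = sqrt ((v - u) / (2 * pi))"
    using integrable_normal[OF n \<sigma>] integrable_normal_power4[OF n \<sigma>] expectation_normal[OF n \<sigma>]
      expectation_normal_abs[OF n \<sigma>] expectation_normal_power4[OF n \<sigma>] expectation_normal_pos_part[OF n \<sigma>]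
    unfolding 4 real_sqrt_mult[symmetric] real_sqrt_divide[symmetric] mult.commute[of "v - u" "2 / pi"] by blast+
qed

text \<open>For the increments from 0 to u, with U = B + e N and V = e B - N, one has (1 + e^2) B =
  U + e V. The term with U has mean zero against sgn V, so e E|V| remains, where V has variance u (1
  + e^2).\<close>

lemma (in wiener_pair) expectation_increment_times_sgn_orth:
  assumes e: "0 < e" and u: "0 < u"
  shows "expectation (\<lambda>\<omega>. (B u \<omega> - B 0 \<omega>) * sgn (orth e u \<omega>)) = sqrt (2 * u * e\<^sup>2 / (pi * (1 + e\<^sup>2)))"
proof -
  interpret sampled_wiener_pair M B N "\<lambda>i. real i * u" 1
    by unfold_locales (use u in auto)
  have pos: "1 + e\<^sup>2 > 0" by (simp add: add_pos_nonneg)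
  have D0: "D 0 = (\<lambda>\<omega>. B u \<omega> - B 0 \<omega>)" and E0: "E 0 = (\<lambda>\<omega>. N u \<omega> - N 0 \<omega>)"
    by (simp_all add: fun_eq_iff D_def E_def)
  have orth: "orth e u \<omega> = e * D 0 \<omega> - E 0 \<omega>" for \<omega>
    by (simp add: orth_def D0 E0)
  have nD: "distributed M lborel (D 0) (normal_density 0 (sqrt u))" and nE: "distributed M lborel (E 0) (normal_density 0 (sqrt u))"
    using normal_D[of 0] normal_E[of 0] by simp_all
  \<comment> \<open>The observed increment itself in the role of h, an unbounded function.\<close>
  have "(\<lambda>v. v 0) \<in> borel_measurable (PiM {..<1} (\<lambda>_. borel) :: (nat \<Rightarrow> real) measure)"
    by (rule measurable_component_singleton) simp
  from expectation_observation_times_sgn[OF this e, of 1]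
  have U: "expectation (\<lambda>\<omega>. (D 0 \<omega> + e * E 0 \<omega>) * sgn (orth e u \<omega>)) = 0"
    by (simp add: orth lessThan_Suc)
  have "distributed M lborel (\<lambda>\<omega>. 0 + e * D 0 \<omega>) (normal_density (0 + e * 0) (\<bar>e\<bar> * sqrt u))"
    by (rule normal_density_affine[OF nD]) (use e u in auto)
  then have neD: "distributed M lborel (\<lambda>\<omega>. e * D 0 \<omega>) (normal_density 0 (e * sqrt u))"
    using e by simp
  have "indep_var borel ((\<lambda>x. e * x) \<circ> D 0) borel (id \<circ> E 0)"
    by (rule indep_var_compose[OF indep_D_E]) auto
  then have ind: "indep_var borel (\<lambda>\<omega>. e * D 0 \<omega>) borel (E 0)"
    by (simp add: comp_def)
  have sq: "(e * sqrt u)\<^sup>2 + (sqrt u)\<^sup>2 = u * (1 + e\<^sup>2)"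
    using u by (simp add: algebra_simps)
  have V: "distributed M lborel (orth e u) (normal_density 0 (sqrt (u * (1 + e\<^sup>2))))"
    using diff_indep_normal[OF ind _ _ neD nE] e u unfolding sq orth[abs_def] by simp
  have "sqrt (u * (1 + e\<^sup>2)) > 0" using u pos by simp
  note V_abs = expectation_normal_abs[OF V this] and V_int = integrable_normal[OF V this]
  have [measurable]: "orth e u \<in> borel_measurable M" using u by simp
  have int: "integrable M (\<lambda>\<omega>. g \<omega> * sgn (orth e u \<omega>))" if "integrable M g" for g
    by (rule Bochner_Integration.integrable_bound[OF that])
      (use that in \<open>auto simp: abs_mult sgn_if\<close>)
  have D_int: "integrable M (D 0)" and E_int: "integrable M (E 0)"
    using integrable_normal[OF nD] integrable_normal[OF nE] u by simp_all
  have "(1 + e\<^sup>2) * expectation (\<lambda>\<omega>. D 0 \<omega> * sgn (orth e u \<omega>))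
      = expectation (\<lambda>\<omega>. (1 + e\<^sup>2) * (D 0 \<omega> * sgn (orth e u \<omega>)))"
    by simp
  also have "\<dots> = expectation (\<lambda>\<omega>. (D 0 \<omega> + e * E 0 \<omega>) * sgn (orth e u \<omega>) + e * \<bar>orth e u \<omega>\<bar>)"
  proof (rule Bochner_Integration.integral_cong[OF refl])
    fix \<omega>
    have "(1 + e\<^sup>2) * D 0 \<omega> = (D 0 \<omega> + e * E 0 \<omega>) + e * orth e u \<omega>"
      by (simp add: orth algebra_simps power2_eq_square)
    then have "(1 + e\<^sup>2) * D 0 \<omega> * sgn (orth e u \<omega>)
        = (D 0 \<omega> + e * E 0 \<omega>) * sgn (orth e u \<omega>) + e * (orth e u \<omega> * sgn (orth e u \<omega>))"
      by (simp add: algebra_simps)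
    then show "(1 + e\<^sup>2) * (D 0 \<omega> * sgn (orth e u \<omega>))
        = (D 0 \<omega> + e * E 0 \<omega>) * sgn (orth e u \<omega>) + e * \<bar>orth e u \<omega>\<bar>"
      by (simp add: mult.assoc abs_sgn)
  qed
  also have "\<dots> = e * (sqrt (u * (1 + e\<^sup>2)) * sqrt (2 / pi))"
    using U V_abs V_int D_int E_int by (subst Bochner_Integration.integral_add) (auto intro!: int)
  finally have *: "(1 + e\<^sup>2) * expectation (\<lambda>\<omega>. D 0 \<omega> * sgn (orth e u \<omega>))
      = e * (sqrt (u * (1 + e\<^sup>2)) * sqrt (2 / pi))" .
  have "q * sqrt (2 * u * e\<^sup>2 / (pi * q)) = e * (sqrt (u * q) * sqrt (2 / pi))" if q: "0 < q" for q
  proof -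
    have "sqrt (2 * u * e\<^sup>2 / (pi * q)) = sqrt 2 * sqrt u * e / (sqrt pi * sqrt q)"
      using e by (simp add: real_sqrt_divide real_sqrt_mult)
    moreover have "q = sqrt q * sqrt q" using q by simp
    ultimately show ?thesis
      using q by (simp add: real_sqrt_divide real_sqrt_mult field_simps)
  qed
  from this[OF pos] have "(1 + e\<^sup>2) * expectation (\<lambda>\<omega>. D 0 \<omega> * sgn (orth e u \<omega>))
      = (1 + e\<^sup>2) * sqrt (2 * u * e\<^sup>2 / (pi * (1 + e\<^sup>2)))"
    unfolding * ..
  then have "expectation (\<lambda>\<omega>. D 0 \<omega> * sgn (orth e u \<omega>)) = sqrt (2 * u * e\<^sup>2 / (pi * (1 + e\<^sup>2)))"
    by (rule mult_left_cancel[THEN iffD1, rotated]) (use pos in simp)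
  then show ?thesis by (simp only: D0)
qed

subsection \<open>Past and future of a sampled pair of Wiener processes\<close>

lemma measurable_from_vimage_algebra:
  assumes "V \<in> vimage_algebra (space M) U R \<rightarrow>\<^sub>M R'" and U: "U \<in> M \<rightarrow>\<^sub>M R"
  shows "V \<in> M \<rightarrow>\<^sub>M R'"
proof -
  have "id \<in> M \<rightarrow>\<^sub>M vimage_algebra (space M) U R"
    using U by (intro measurable_vimage_algebra2) (auto simp: comp_def)
  from measurable_comp[OF this assms(1)] show ?thesis by simp
qed

lemma sigma_sets_vimage_algebra_subset:
  assumes "V \<in> vimage_algebra \<Omega> U R \<rightarrow>\<^sub>M R'"
  shows "sigma_sets \<Omega> {V -` A \<inter> \<Omega> | A. A \<in> sets R'} \<subseteq> sigma_sets \<Omega> {U -` A \<inter> \<Omega> | A. A \<in> sets R}"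
  using measurable_sets[OF assms] by (intro sigma_sets_mono) (auto simp: sets_vimage_algebra)

text \<open>Independence passes to anything measurable for the generated algebras, so past
  quantities such as survival indicators need not be written as explicit functions of the increment
  vector.\<close>

lemma (in prob_space) indep_var_vimage_algebra:
  assumes XY: "indep_var S X T Y"
    and W: "W \<in> vimage_algebra (space M) X S \<rightarrow>\<^sub>M S'" and Z: "Z \<in> vimage_algebra (space M) Y T \<rightarrow>\<^sub>M T'"
  shows "indep_var S' W T' Z"
proof -
  have X: "X \<in> M \<rightarrow>\<^sub>M S" and Y: "Y \<in> M \<rightarrow>\<^sub>M T"
    using XY by (auto dest: indep_var_rv1 indep_var_rv2)
  note sub = sigma_sets_vimage_algebra_subset[OF W] sigma_sets_vimage_algebra_subset[OF Z]
  from XY have "indep_set (sigma_sets (space M) {X -` A \<inter> space M | A. A \<in> sets S})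
      (sigma_sets (space M) {Y -` A \<inter> space M | A. A \<in> sets T})"
    unfolding indep_var_eq by simp
  then have "indep_set (sigma_sets (space M) {W -` A \<inter> space M | A. A \<in> sets S'})
      (sigma_sets (space M) {Z -` A \<inter> space M | A. A \<in> sets T'})"
    unfolding indep_sets2_eq using sub by (meson subsetD subset_trans)
  then show ?thesis
    unfolding indep_var_eq
    using measurable_from_vimage_algebra[OF W X] measurable_from_vimage_algebra[OF Z Y] by simp
qed

context sampled_wiener_pair
begin

text \<open>The increments of N belong to the past along with those of B, because the sign of the
  orthogonal noise depends on both.\<close>

definition past :: "nat \<Rightarrow> 'a measure" where
  "past i = vimage_algebra (space M) (\<lambda>\<omega>. \<lambda>j\<in>{..<i}. (D j \<omega>, E j \<omega>)) (PiM {..<i} (\<lambda>_. borel \<Otimes>\<^sub>M borel))"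

definition future :: "nat \<Rightarrow> 'a measure" where
  "future i = vimage_algebra (space M) (\<lambda>\<omega>. \<lambda>j\<in>{i..<k}. (D j \<omega>, E j \<omega>)) (PiM {i..<k} (\<lambda>_. borel \<Otimes>\<^sub>M borel))"

lemma indep_future_past:
  assumes "i \<le> k" "W \<in> future i \<rightarrow>\<^sub>M S" "Z \<in> past i \<rightarrow>\<^sub>M T"
  shows "indep_var S W T Z"
proof (rule indep_var_vimage_algebra)
  show "indep_var (PiM {i..<k} (\<lambda>_. borel \<Otimes>\<^sub>M borel)) (\<lambda>\<omega>. \<lambda>j\<in>{i..<k}. (D j \<omega>, E j \<omega>))
      (PiM {..<i} (\<lambda>_. borel \<Otimes>\<^sub>M borel)) (\<lambda>\<omega>. \<lambda>j\<in>{..<i}. (D j \<omega>, E j \<omega>))"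
    using assms(1) by (intro indep_var_restrict[OF indep_pairs]) auto
qed (use assms in \<open>simp_all add: past_def future_def\<close>)

lemma borel_measurable_past_imp:
  "i \<le> k \<Longrightarrow> Z \<in> borel_measurable (past i) \<Longrightarrow> Z \<in> borel_measurable M" for Z :: "'a \<Rightarrow> real"
  using indep_future_past[of i "\<lambda>_. 0 :: real" borel Z borel] by (auto dest: indep_var_rv2)

lemma borel_measurable_vimage_algebra_increments:
  fixes I :: "nat set"
  assumes "j \<in> I"
  shows "D j \<in> borel_measurable (vimage_algebra (space M) (\<lambda>\<omega>. \<lambda>j\<in>I. (D j \<omega>, E j \<omega>)) (PiM I (\<lambda>_. borel \<Otimes>\<^sub>M borel)))"
    and "E j \<in> borel_measurable (vimage_algebra (space M) (\<lambda>\<omega>. \<lambda>j\<in>I. (D j \<omega>, E j \<omega>)) (PiM I (\<lambda>_. borel \<Otimes>\<^sub>M borel)))"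
proof -
  let ?f = "\<lambda>\<omega>. \<lambda>j\<in>I. (D j \<omega>, E j \<omega>)" and ?P = "PiM I (\<lambda>_. borel \<Otimes>\<^sub>M borel) :: (nat \<Rightarrow> real \<times> real) measure"
  have f: "?f \<in> vimage_algebra (space M) ?f ?P \<rightarrow>\<^sub>M ?P"
    by (rule measurable_vimage_algebra1) (auto simp: space_PiM space_pair_measure)
  have g: "(\<lambda>p. p j) \<in> ?P \<rightarrow>\<^sub>M borel \<Otimes>\<^sub>M borel"
    using assms by (rule measurable_component_singleton)
  from measurable_compose[OF measurable_compose[OF f g] measurable_fst]
    measurable_compose[OF measurable_compose[OF f g] measurable_snd] assms
  show "D j \<in> borel_measurable (vimage_algebra (space M) ?f ?P)"
    "E j \<in> borel_measurable (vimage_algebra (space M) ?f ?P)"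
    by simp_all
qed

lemma borel_measurable_past: "j < i \<Longrightarrow> D j \<in> borel_measurable (past i)" "j < i \<Longrightarrow> E j \<in> borel_measurable (past i)"
  unfolding past_def by (rule borel_measurable_vimage_algebra_increments; simp)+

lemma borel_measurable_future: "i \<le> j \<Longrightarrow> j < k \<Longrightarrow> D j \<in> borel_measurable (future i)"
  unfolding future_def by (rule borel_measurable_vimage_algebra_increments; simp)

lemma sum_D: "(\<Sum>i<j. D i \<omega>) = B (t j) \<omega> - B (t 0) \<omega>"
  unfolding D_def by (rule sum_lessThan_telescope)

lemma sum_E: "(\<Sum>i<j. E i \<omega>) = N (t j) \<omega> - N (t 0) \<omega>"
  unfolding E_def by (rule sum_lessThan_telescope)

lemma sum_D_interval: "i \<le> j \<Longrightarrow> (\<Sum>i\<in>{i..<j}. D i \<omega>) = B (t j) \<omega> - B (t i) \<omega>"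
  unfolding D_def by (rule sum_Suc_diff')

lemma integrable_D: "i < k \<Longrightarrow> integrable M (D i)"
  using B.integrable_increment[of "t i" "t (Suc i)"] t_nonneg[of i] t_less[of i] by (simp add: D_def[abs_def])

lemma expectation_D: "i < k \<Longrightarrow> expectation (D i) = 0"
  using B.expectation_increment[of "t i" "t (Suc i)"] t_nonneg[of i] t_less[of i] by (simp add: D_def[abs_def])

text \<open>The discrete martingale property: increment i is centred and independent of
  \<open>past i\<close>. Applied term by term to sums weighted by survival indicators, it is the
  optional stopping theorem.\<close>

lemma
  assumes i: "i < k" and Q: "Q \<in> borel_measurable (past i)" and b: "\<And>\<omega>. \<bar>Q \<omega>\<bar> \<le> (b::real)"
  shows integrable_D_times_past: "integrable M (\<lambda>\<omega>. D i \<omega> * Q \<omega>)"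
    and expectation_D_times_past: "expectation (\<lambda>\<omega>. D i \<omega> * Q \<omega>) = 0"
proof -
  have ind: "indep_var borel (D i) borel Q"
    using i by (intro indep_future_past[OF _ borel_measurable_future Q]) auto
  have "integrable M Q"
    using borel_measurable_past_imp[OF _ Q] i b by (intro integrable_const_bound[of _ b]) auto
  with indep_var_integrable[OF ind integrable_D[OF i]] indep_var_lebesgue_integral[OF ind integrable_D[OF i]]
  show "integrable M (\<lambda>\<omega>. D i \<omega> * Q \<omega>)" "expectation (\<lambda>\<omega>. D i \<omega> * Q \<omega>) = 0"
    by (simp_all add: expectation_D[OF i])
qed

text \<open>Stands in for the strong Markov property: Q will indicate that the level is first
  reached at index i, and the increment from i to j is independent of that event.\<close>

lemma
  assumes ij: "i < j" "j \<le> k" and Q: "Q \<in> borel_measurable (past i)" and b: "\<And>\<omega>. \<bar>Q \<omega>\<bar> \<le> (b::real)"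
  shows integrable_past_times_abs: "integrable M (\<lambda>\<omega>. Q \<omega> * \<bar>B (t j) \<omega> - B (t i) \<omega>\<bar>)"
    and expectation_past_times_abs:
      "expectation (\<lambda>\<omega>. Q \<omega> * \<bar>B (t j) \<omega> - B (t i) \<omega>\<bar>) = expectation Q * sqrt (2 / pi * (t j - t i))"
proof -
  have less: "t i < t j"
    using ij
  proof (induction j)
    case (Suc j)
    then show ?case using t_less[of j] by (cases "i = j") auto
  qed simp
  have "(\<lambda>\<omega>. \<bar>\<Sum>l\<in>{i..<j}. D l \<omega>\<bar>) \<in> borel_measurable (future i)"
    using ij by (intro borel_measurable_abs borel_measurable_sum borel_measurable_future) auto
  then have "(\<lambda>\<omega>. \<bar>B (t j) \<omega> - B (t i) \<omega>\<bar>) \<in> borel_measurable (future i)"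
    using ij by (simp add: sum_D_interval)
  from indep_future_past[OF _ this Q]
  have ind: "indep_var borel (\<lambda>\<omega>. \<bar>B (t j) \<omega> - B (t i) \<omega>\<bar>) borel Q"
    using ij by simp
  have Q_int: "integrable M Q"
    using borel_measurable_past_imp[OF _ Q] ij b by (intro integrable_const_bound[of _ b]) auto
  have i: "0 \<le> t i" using t_nonneg ij by simp
  note int = integrable_abs[OF B.integrable_increment[OF i less]]
  show "integrable M (\<lambda>\<omega>. Q \<omega> * \<bar>B (t j) \<omega> - B (t i) \<omega>\<bar>)"
    using indep_var_integrable[OF ind int Q_int] by (simp add: mult.commute)
  show "expectation (\<lambda>\<omega>. Q \<omega> * \<bar>B (t j) \<omega> - B (t i) \<omega>\<bar>) = expectation Q * sqrt (2 / pi * (t j - t i))"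
    using indep_var_lebesgue_integral[OF ind int Q_int]
    unfolding B.expectation_increment_abs[OF i less] by (simp add: mult.commute)
qed

end

subsection \<open>The stopped walk on a grid\<close>

text \<open>Summation by parts. With F the indicators of the first passage index, it turns sums
  weighted by \<open>1 - alive i\<close> into sums over that index.\<close>

lemma sum_mult_partial_sums:
  fixes x F :: "nat \<Rightarrow> 'b :: comm_semiring_0"
  shows "(\<Sum>i<m. x i * (\<Sum>j\<le>i. F j)) = (\<Sum>j<m. F j * (\<Sum>i\<in>{j..<m}. x i))"
proof (induction m)
  case (Suc m)
  have "(\<Sum>j<Suc m. F j * (\<Sum>i\<in>{j..<Suc m}. x i)) = (\<Sum>j<Suc m. F j * ((\<Sum>i\<in>{j..<m}. x i) + x m))"
    by (intro sum.cong) auto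
  also have "\<dots> = (\<Sum>j<m. F j * (\<Sum>i\<in>{j..<m}. x i)) + x m * (\<Sum>j\<le>m. F j)"
    by (simp add: sum.distrib sum_distrib_left algebra_simps lessThan_Suc_atMost[symmetric])
  finally show ?case by (simp add: Suc.IH)
qed simp

text \<open>If x exceeds c, then x is at most x (x / c)^3. In the overshoot bound c is sent to 0
  after the mesh; at the horizon c is the distance from the level to the mean of the walk.\<close>

lemma le_add_power4:
  fixes x c :: real
  assumes c: "0 < c"
  shows "x \<le> c + x ^ 4 / c ^ 3"
proof (cases "x \<le> c")
  case True
  then show ?thesis using c by (simp add: add_increasing2)
next
  case False
  then have "c ^ 3 \<le> x ^ 3" using c by (intro power_mono) auto
  then have "x * c ^ 3 \<le> x * x ^ 3" using False c by (intro mult_left_mono) auto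
  then have "x \<le> x ^ 4 / c ^ 3"
    using c by (simp add: field_simps power4_eq_xxxx power3_eq_cube)
  then show ?thesis using c by simp
qed

text \<open>\<open>real m * \<delta>\<close> is the time n of the theorem and
  \<open>real K * \<delta>\<close> a finite horizon beyond it. By \<open>level\<close>, the drift
  alone does not carry the walk above l by time n.\<close>

locale stopped_walk = wiener_pair +
  fixes e s \<delta> l :: real and m K :: nat
  assumes e: "0 < e" and s: "0 < s" and \<delta>: "0 < \<delta>" and l: "0 < l"
    and m: "0 < m" "m < K" and level: "s * (real m * \<delta>) \<le> l"
begin

sublocale sampled_wiener_pair M B N "\<lambda>i. real i * \<delta>" K
  by unfold_locales (use \<delta> in auto)

definition X :: "nat \<Rightarrow> 'a \<Rightarrow> real" where
  "X i \<omega> = B (real i * \<delta>) \<omega> - B 0 \<omega> + s * (real i * \<delta>)"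

definition alive :: "nat \<Rightarrow> 'a \<Rightarrow> real" where
  "alive i \<omega> = (\<Prod>j\<le>i. of_bool (X j \<omega> < l))"

text \<open>Survival is nonincreasing in the index, so the number of surviving indices below K is
  the first index at which the walk reaches l, or K if there is none.\<close>

definition stop :: "'a \<Rightarrow> real" where
  "stop \<omega> = \<delta> * (\<Sum>i<K. alive i \<omega>)"

text \<open>\<open>Z j\<close> is the walk stopped at its first grid time above the level.\<close>

definition Z :: "nat \<Rightarrow> 'a \<Rightarrow> real" where
  "Z j \<omega> = (\<Sum>i<j. (D i \<omega> + s * \<delta>) * alive i \<omega>)"

definition S :: "'a \<Rightarrow> real" where
  "S \<omega> = sgn (orth e (real m * \<delta>) \<omega>)"

lemma X_0: "X 0 \<omega> = 0"
  by (simp add: X_def)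

lemma X_Suc: "X (Suc i) \<omega> = X i \<omega> + (D i \<omega> + s * \<delta>)"
  unfolding X_def D_def by (simp add: algebra_simps)

lemma X_sum: "X j \<omega> = (\<Sum>i<j. D i \<omega> + s * \<delta>)"
  by (induction j) (simp_all add: X_0 X_Suc)

lemma alive_0: "alive 0 \<omega> = 1"
  using l by (simp add: alive_def X_0)

lemma alive_Suc: "alive (Suc i) \<omega> = alive i \<omega> * of_bool (X (Suc i) \<omega> < l)"
  by (simp add: alive_def)

lemma alive_cases: "alive i \<omega> = 0 \<or> alive i \<omega> = 1"
  by (induction i) (auto simp: alive_0 alive_Suc)

lemma alive_bounds: "0 \<le> alive i \<omega>" "alive i \<omega> \<le> 1"
  using alive_cases[of i \<omega>] by auto

lemma alive_compl_bound: "\<bar>1 - alive i \<omega>\<bar> \<le> 1"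
  using alive_cases[of i \<omega>] by auto

lemma Z_eq_X: "alive j \<omega> = 1 \<Longrightarrow> Z j \<omega> = X j \<omega> \<and> X j \<omega> < l"
proof (induction j)
  case 0
  then show ?case using l by (simp add: Z_def X_0)
next
  case (Suc j)
  then have "alive j \<omega> = 1" "X (Suc j) \<omega> < l"
    using alive_cases[of j \<omega>] by (auto simp: alive_Suc)
  with Suc.IH show ?case by (simp add: Z_def X_Suc)
qed

text \<open>The fourth moments are there to bound the largest of the \<open>K\<close> increments: the sum of their
  squares would not vanish with the mesh.\<close>

lemma Z_overshoot:
  assumes c: "0 < c"
  shows "alive j \<omega> = 0 \<Longrightarrow> l \<le> Z j \<omega> \<and> Z j \<omega> \<le> l + s * \<delta> + c + (\<Sum>i<j. D i \<omega> ^ 4) / c ^ 3"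
proof (induction j)
  case 0
  then show ?case by (simp add: alive_0)
next
  case (Suc j)
  show ?case
  proof (cases "alive j \<omega> = 0")
    case True
    then have "Z (Suc j) \<omega> = Z j \<omega>" by (simp add: Z_def)
    moreover have "(\<Sum>i<j. D i \<omega> ^ 4) / c ^ 3 \<le> (\<Sum>i<Suc j. D i \<omega> ^ 4) / c ^ 3"
      using c by (intro divide_right_mono) auto
    ultimately show ?thesis using Suc.IH[OF True] by simp
  next
    case False
    then have 1: "alive j \<omega> = 1" using alive_cases[of j \<omega>] by simp
    with Z_eq_X[OF 1] have Z: "Z (Suc j) \<omega> = X (Suc j) \<omega>" and X: "X j \<omega> < l"
      by (simp_all add: Z_def X_Suc)
    have "l \<le> X (Suc j) \<omega>" using Suc.prems 1 by (simp add: alive_Suc)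
    moreover have "D j \<omega> \<le> c + D j \<omega> ^ 4 / c ^ 3" by (rule le_add_power4[OF c])
    moreover have "D j \<omega> ^ 4 / c ^ 3 \<le> (\<Sum>i<Suc j. D i \<omega> ^ 4) / c ^ 3"
      using c by (intro divide_right_mono member_le_sum) auto
    ultimately show ?thesis using X unfolding Z X_Suc by linarith
  qed
qed

text \<open>At the horizon the walk is either still below l, at distance l - X K, or has stopped
  with an overshoot.\<close>

lemma Z_dist_level:
  assumes c: "0 < c"
  shows "\<bar>Z K \<omega> - l\<bar> \<le> max 0 (l - X K \<omega>) + s * \<delta> + c + (\<Sum>i<K. D i \<omega> ^ 4) / c ^ 3"
proof -
  have "0 \<le> s * \<delta> + c + (\<Sum>i<K. D i \<omega> ^ 4) / c ^ 3"
    using s \<delta> c by (intro add_nonneg_nonneg divide_nonneg_nonneg sum_nonneg) auto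
  then show ?thesis
    using alive_cases[of K \<omega>] Z_eq_X[of K \<omega>] Z_overshoot[OF c, of K \<omega>] by auto
qed

lemma S_bound: "\<bar>S \<omega>\<bar> \<le> 1"
  by (simp add: S_def sgn_if)

lemma X_past: "j \<le> i \<Longrightarrow> X j \<in> borel_measurable (past i)"
  unfolding X_sum[abs_def]
  by (intro borel_measurable_sum borel_measurable_add borel_measurable_past) auto

lemma alive_past: "j \<le> i \<Longrightarrow> alive j \<in> borel_measurable (past i)"
proof (induction j)
  case 0
  then show ?case by (simp add: alive_0[abs_def])
next
  case (Suc j)
  have "(\<lambda>\<omega>. indicator {..<l} (X (Suc j) \<omega>) :: real) \<in> borel_measurable (past i)"
    using X_past[OF Suc.prems] by measurable
  then show ?case
    using Suc unfolding alive_Suc[abs_def] by (auto intro!: borel_measurable_times simp: indicator_def of_bool_def)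
qed

lemma S_past: "m \<le> i \<Longrightarrow> S \<in> borel_measurable (past i)"
proof -
  assume i: "m \<le> i"
  have "(\<lambda>\<omega>. \<Sum>j<m. e * D j \<omega> - E j \<omega>) \<in> borel_measurable (past i)"
    using i by (intro borel_measurable_sum borel_measurable_diff borel_measurable_times borel_measurable_past) auto
  moreover have "(\<Sum>j<m. e * D j \<omega> - E j \<omega>) = orth e (real m * \<delta>) \<omega>" for \<omega>
    unfolding sum_subtractf sum_distrib_left[symmetric] sum_D sum_E by (simp add: orth_def)
  ultimately show ?thesis
    unfolding S_def[abs_def] by simp
qed

lemma rv_alive [measurable]: "i \<le> K \<Longrightarrow> alive i \<in> borel_measurable M"
  by (rule borel_measurable_past_imp[OF _ alive_past[OF order_refl]])

lemma rv_S [measurable]: "S \<in> borel_measurable M"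
  using borel_measurable_past_imp[OF order_refl S_past] m by simp

lemma integrable_alive: "i \<le> K \<Longrightarrow> integrable M (alive i)"
  using alive_bounds by (intro integrable_const_bound[of _ 1]) auto

text \<open>\<delta> times the sum is (n - \<tau>)_+ on the grid. Between \<tau> and n the walk
  moves by X m - Z m, which is the drift over the time lost plus a martingale part of mean
  zero.\<close>

lemma expectation_time_lost:
  "s * expectation (\<lambda>\<omega>. \<delta> * (\<Sum>i<m. 1 - alive i \<omega>)) \<le> sqrt (real m * \<delta> / (2 * pi))"
proof -
  let ?b = "\<lambda>\<omega>. B (real m * \<delta>) \<omega> - B 0 \<omega>"
  have md: "0 < real m * \<delta>" using m \<delta> by simp
  have int: "integrable M (\<lambda>\<omega>. D i \<omega> * (1 - alive i \<omega>))"
    and exp: "expectation (\<lambda>\<omega>. D i \<omega> * (1 - alive i \<omega>)) = 0" if "i < m" for i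
    using that m alive_compl_bound
    by (auto intro!: integrable_D_times_past[where b=1] expectation_D_times_past[where b=1]
        borel_measurable_diff alive_past)
  have int_s: "integrable M (\<lambda>\<omega>. \<Sum>i<m. D i \<omega> * (1 - alive i \<omega>))"
    using int by (intro Bochner_Integration.integrable_sum) auto
  have int_T: "integrable M (\<lambda>\<omega>. \<delta> * (\<Sum>i<m. 1 - alive i \<omega>))"
    using m by (intro integrable_mult_right Bochner_Integration.integrable_sum Bochner_Integration.integrable_diff
        integrable_alive) auto
  have int_b: "integrable M (\<lambda>\<omega>. max 0 (?b \<omega>))"
    using B.integrable_increment[OF order_refl md] by simp
  have le: "s * (\<delta> * (\<Sum>i<m. 1 - alive i \<omega>)) + (\<Sum>i<m. D i \<omega> * (1 - alive i \<omega>)) \<le> max 0 (?b \<omega>)" for \<omega>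
  proof -
    have "s * (\<delta> * (\<Sum>i<m. 1 - alive i \<omega>)) + (\<Sum>i<m. D i \<omega> * (1 - alive i \<omega>))
        = (\<Sum>i<m. (D i \<omega> + s * \<delta>) * (1 - alive i \<omega>))"
      unfolding sum_distrib_left sum.distrib[symmetric] by (intro sum.cong refl) algebra
    also have "\<dots> = X m \<omega> - Z m \<omega>"
      unfolding X_sum Z_def by (simp add: sum_subtractf right_diff_distrib)
    \<comment> \<open>If alive, the difference is 0; otherwise Z m is at least l, hence by
      \<open>level\<close> at least the drift part of X m. Only the lower bound of
      \<open>Z_overshoot\<close> is taken, so its c may be 1.\<close>
    also have "\<dots> \<le> max 0 (?b \<omega>)"
      using alive_cases[of m \<omega>] Z_eq_X[of m \<omega>] Z_overshoot[OF zero_less_one, of m \<omega>] level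
      by (auto simp: X_def)
    finally show ?thesis .
  qed
  have "s * expectation (\<lambda>\<omega>. \<delta> * (\<Sum>i<m. 1 - alive i \<omega>))
      = expectation (\<lambda>\<omega>. s * (\<delta> * (\<Sum>i<m. 1 - alive i \<omega>)) + (\<Sum>i<m. D i \<omega> * (1 - alive i \<omega>)))"
  proof -
    have "expectation (\<lambda>\<omega>. \<Sum>i<m. D i \<omega> * (1 - alive i \<omega>)) = 0"
      using int exp by (subst Bochner_Integration.integral_sum) auto
    then show ?thesis
      using integrable_mult_right[OF int_T, of s] int_s by (subst Bochner_Integration.integral_add) simp_all
  qed
  also have "\<dots> \<le> expectation (\<lambda>\<omega>. max 0 (?b \<omega>))"
    by (rule integral_mono[OF Bochner_Integration.integrable_add[OF integrable_mult_right[OF int_T] int_s] int_b le])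
  also have "\<dots> = sqrt (real m * \<delta> / (2 * pi))"
    using B.expectation_increment_pos_part[OF order_refl md] by simp
  finally show ?thesis .
qed

text \<open>\<open>F j\<close> indicates that \<open>j\<close> is the first grid index at which the level is reached.\<close>

definition F :: "nat \<Rightarrow> 'a \<Rightarrow> real" where
  "F j \<omega> = (if j = 0 then 1 - alive 0 \<omega> else alive (j - 1) \<omega> - alive j \<omega>)"

lemma sum_F: "(\<Sum>j\<le>i. F j \<omega>) = 1 - alive i \<omega>"
  by (induction i) (simp_all add: F_def)

lemma F_bounds: "0 \<le> F j \<omega>" "F j \<omega> \<le> 1"
proof -
  have "0 \<le> F j \<omega> \<and> F j \<omega> \<le> 1"
  proof (cases j)
    case (Suc i)
    then show ?thesis using alive_cases[of i \<omega>] by (auto simp: F_def alive_Suc)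
  qed (simp add: F_def alive_0)
  then show "0 \<le> F j \<omega>" "F j \<omega> \<le> 1" by auto
qed

lemma F_past: "F j \<in> borel_measurable (past j)"
  unfolding F_def[abs_def] by (cases "j = 0") (auto intro!: borel_measurable_diff alive_past)

lemma integrable_F: "j \<le> K \<Longrightarrow> integrable M (F j)"
  using F_bounds borel_measurable_past_imp[OF _ F_past] by (intro integrable_const_bound[of _ 1]) auto

text \<open>The sum is the increment of B from \<tau> to n when \<tau> < n. Splitting it by the
  first passage index j leaves F j times an increment after j, two independent factors.\<close>

lemma
  shows integrable_increments_lost: "integrable M (\<lambda>\<omega>. \<Sum>i<m. D i \<omega> * (1 - alive i \<omega>))"
    and expectation_increments_lost:
      "expectation (\<lambda>\<omega>. \<bar>\<Sum>i<m. D i \<omega> * (1 - alive i \<omega>)\<bar>)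
        \<le> sqrt (2 / pi) * sqrt (sqrt (real m * \<delta> / (2 * pi)) / s)"
proof -
  let ?b = "\<lambda>j \<omega>. B (real m * \<delta>) \<omega> - B (real j * \<delta>) \<omega>"
  let ?r = "\<lambda>j. real m * \<delta> - real j * \<delta>"
  \<comment> \<open>Q bounds E (n - \<tau>)_+. Jensen's inequality for the square root is replaced
    by its linear bound sqrt r \<le> (r / q + q) / 2, and q = sqrt Q is the choice that gives sqrt Q
    after averaging.\<close>
  define Q where "Q = sqrt (real m * \<delta> / (2 * pi)) / s"
  define q where "q = sqrt Q"
  have Q: "0 < Q" using m \<delta> s by (simp add: Q_def)
  then have q: "0 < q" "q * q = Q" by (simp_all add: q_def)
  have int: "integrable M (\<lambda>\<omega>. D i \<omega> * (1 - alive i \<omega>))" if "i < m" for i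
    using that m alive_compl_bound
    by (auto intro!: integrable_D_times_past[where b=1] borel_measurable_diff alive_past)
  then show int_sum: "integrable M (\<lambda>\<omega>. \<Sum>i<m. D i \<omega> * (1 - alive i \<omega>))"
    by (intro Bochner_Integration.integrable_sum) auto
  have F_int: "integrable M (\<lambda>\<omega>. F j \<omega> * \<bar>?b j \<omega>\<bar>)"
    and F_exp: "expectation (\<lambda>\<omega>. F j \<omega> * \<bar>?b j \<omega>\<bar>) = expectation (F j) * sqrt (2 / pi * ?r j)" if "j < m" for j
    using that m F_bounds
    by (intro integrable_past_times_abs[where b=1] expectation_past_times_abs[where b=1] F_past; simp)+
  have E_F: "0 \<le> expectation (F j)" for j
    by (intro Bochner_Integration.integral_nonneg F_bounds)
  have "(\<Sum>i<m. D i \<omega> * (1 - alive i \<omega>)) = (\<Sum>j<m. F j \<omega> * ?b j \<omega>)" for \<omega>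
  proof -
    have "(\<Sum>i<m. D i \<omega> * (1 - alive i \<omega>)) = (\<Sum>j<m. F j \<omega> * (\<Sum>i\<in>{j..<m}. D i \<omega>))"
      by (simp add: sum_mult_partial_sums flip: sum_F)
    also have "\<dots> = (\<Sum>j<m. F j \<omega> * ?b j \<omega>)"
      by (intro sum.cong) (auto simp: sum_D_interval)
    finally show ?thesis .
  qed
  then have "\<bar>\<Sum>i<m. D i \<omega> * (1 - alive i \<omega>)\<bar> \<le> (\<Sum>j<m. F j \<omega> * \<bar>?b j \<omega>\<bar>)" for \<omega>
    using sum_abs[of "\<lambda>j. F j \<omega> * ?b j \<omega>" "{..<m}"] F_bounds by (simp add: abs_mult)
  then have "expectation (\<lambda>\<omega>. \<bar>\<Sum>i<m. D i \<omega> * (1 - alive i \<omega>)\<bar>)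
      \<le> expectation (\<lambda>\<omega>. \<Sum>j<m. F j \<omega> * \<bar>?b j \<omega>\<bar>)"
    using int_sum F_int by (intro integral_mono) auto
  also have "\<dots> = (\<Sum>j<m. expectation (F j) * sqrt (2 / pi * ?r j))"
    using F_int F_exp by (subst Bochner_Integration.integral_sum) auto
  also have "\<dots> \<le> (\<Sum>j<m. expectation (F j) * (sqrt (2 / pi) * ((?r j / q + q) / 2)))"
  proof (intro sum_mono mult_left_mono E_F)
    fix j assume "j \<in> {..<m}"
    then have "0 \<le> ?r j" using \<delta> by simp
    then have "sqrt (?r j / q * q) \<le> (?r j / q + q) / 2"
      using q by (intro arith_geo_mean_sqrt) auto
    then show "sqrt (2 / pi * ?r j) \<le> sqrt (2 / pi) * ((?r j / q + q) / 2)"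
      unfolding real_sqrt_mult[of "2 / pi"] using q by (intro mult_left_mono) auto
  qed
  also have "\<dots> = sqrt (2 / pi) / 2 * ((\<Sum>j<m. expectation (F j) * ?r j) / q + q * (\<Sum>j<m. expectation (F j)))"
    unfolding sum_divide_distrib sum_distrib_left sum.distrib[symmetric]
    using q by (intro sum.cong refl) (simp add: field_simps)
  also have "\<dots> \<le> sqrt (2 / pi) / 2 * (Q / q + q * 1)"
  proof (intro mult_left_mono add_mono divide_right_mono)
    \<comment> \<open>Summation by parts again, with the constant \<delta> in place of the
      increments: the time from first passage to n is the time lost.\<close>
    have "(\<Sum>j<m. F j \<omega> * ?r j) = \<delta> * (\<Sum>i<m. 1 - alive i \<omega>)" for \<omega>
    proof -
      have "\<delta> * (\<Sum>i<m. 1 - alive i \<omega>) = (\<Sum>i<m. \<delta> * (\<Sum>j\<le>i. F j \<omega>))"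
        by (simp add: sum_F sum_distrib_left)
      also have "\<dots> = (\<Sum>j<m. F j \<omega> * (\<Sum>i\<in>{j..<m}. \<delta>))"
        by (rule sum_mult_partial_sums)
      also have "\<dots> = (\<Sum>j<m. F j \<omega> * ?r j)"
        by (intro sum.cong) (auto simp: algebra_simps)
      finally show ?thesis ..
    qed
    then have "expectation (\<lambda>\<omega>. \<delta> * (\<Sum>i<m. 1 - alive i \<omega>)) = expectation (\<lambda>\<omega>. \<Sum>j<m. F j \<omega> * ?r j)"
      by (simp only:)
    also have "\<dots> = (\<Sum>j<m. expectation (F j) * ?r j)"
      using m integrable_F by (subst Bochner_Integration.integral_sum) auto
    finally have "(\<Sum>j<m. expectation (F j) * ?r j) = expectation (\<lambda>\<omega>. \<delta> * (\<Sum>i<m. 1 - alive i \<omega>))" ..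
    also have "\<dots> \<le> Q"
      using expectation_time_lost s by (simp add: Q_def field_simps)
    finally show "(\<Sum>j<m. expectation (F j) * ?r j) \<le> Q" .
    have "(\<Sum>j<m. F j \<omega>) \<le> 1" for \<omega>
      using sum_F[of \<omega> "m - 1"] m alive_bounds(1)[of "m - 1" \<omega>] by (cases m) (auto simp: lessThan_Suc_atMost)
    then have "expectation (\<lambda>\<omega>. \<Sum>j<m. F j \<omega>) \<le> expectation (\<lambda>\<omega>. 1)"
      using m integrable_F by (intro integral_mono) auto
    then show "(\<Sum>j<m. expectation (F j)) \<le> 1"
      using m integrable_F by (subst (asm) Bochner_Integration.integral_sum) (auto simp: prob_space)
  qed (use q in auto)
  also have "\<dots> = sqrt (2 / pi) * q"
    using q by (simp add: field_simps flip: q(2))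
  finally show "expectation (\<lambda>\<omega>. \<bar>\<Sum>i<m. D i \<omega> * (1 - alive i \<omega>)\<bar>)
      \<le> sqrt (2 / pi) * sqrt (sqrt (real m * \<delta> / (2 * pi)) / s)"
    by (simp add: q_def Q_def)
qed

end

section \<open>The duality inequality on the grid\<close>

context stopped_walk
begin

lemma integrable_X: "i \<le> K \<Longrightarrow> integrable M (X i)"
  unfolding X_sum[abs_def] by (intro Bochner_Integration.integrable_sum Bochner_Integration.integrable_add integrable_D) auto

lemma rv_stop: "stop \<in> borel_measurable M"
  unfolding stop_def[abs_def] by (intro borel_measurable_times borel_measurable_sum rv_alive) auto

lemma stop_bounds: "0 \<le> stop \<omega>" "stop \<omega> \<le> \<delta> * K"
proof -
  show "0 \<le> stop \<omega>"
    unfolding stop_def using \<delta> alive_bounds by (intro mult_nonneg_nonneg sum_nonneg) auto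
  have "(\<Sum>i<K. alive i \<omega>) \<le> (\<Sum>i<K. 1)"
    by (intro sum_mono alive_bounds)
  then show "stop \<omega> \<le> \<delta> * K"
    unfolding stop_def using \<delta> by (intro mult_left_mono) auto
qed

text \<open>The formula s \<tau> = X_\<tau> - B_\<tau>, with B_\<tau> expanded about B_n: increments
  between \<tau> and n are removed if \<tau> < n, those between n and \<tau> are added if \<tau> >
  n.\<close>

lemma time_stop:
  "s * stop \<omega> = Z K \<omega> - (B (real m * \<delta>) \<omega> - B 0 \<omega>) + (\<Sum>i<m. D i \<omega> * (1 - alive i \<omega>))
    - (\<Sum>i\<in>{m..<K}. D i \<omega> * alive i \<omega>)"
proof -
  have "Z K \<omega> = (\<Sum>i<K. D i \<omega> * alive i \<omega>) + s * stop \<omega>"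
    unfolding Z_def stop_def by (simp add: distrib_right sum.distrib sum_distrib_left mult.assoc)
  moreover have "(\<Sum>i<K. D i \<omega> * alive i \<omega>) = (\<Sum>i<m. D i \<omega> * alive i \<omega>) + (\<Sum>i\<in>{m..<K}. D i \<omega> * alive i \<omega>)"
    using m sum.atLeastLessThan_concat[of 0 m K "\<lambda>i. D i \<omega> * alive i \<omega>"] by (simp add: lessThan_atLeast0)
  moreover have "(\<Sum>i<m. D i \<omega> * alive i \<omega>) = (\<Sum>i<m. D i \<omega>) - (\<Sum>i<m. D i \<omega> * (1 - alive i \<omega>))"
    unfolding sum_subtractf[symmetric] by (intro sum.cong refl) algebra
  moreover have "(\<Sum>i<m. D i \<omega>) = B (real m * \<delta>) \<omega> - B 0 \<omega>"
    by (simp add: sum_D)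
  ultimately show ?thesis by simp
qed

text \<open>After multiplication by S, the estimator, the constant l and the increments after n all
  have mean zero. What remains is B at n against the increments lost before n and the error in
  replacing Z K by l.\<close>

lemma expectation_estimation_error:
  fixes f :: "(real \<Rightarrow> real) \<Rightarrow> real"
  assumes f [measurable]: "f \<in> borel_measurable path_space" and bound: "\<And>w. \<bar>f w\<bar> \<le> b"
    and c: "0 < c"
  shows "sqrt (2 * (real m * \<delta>) * e\<^sup>2 / (pi * (1 + e\<^sup>2))) - sqrt (2 / pi) * sqrt (sqrt (real m * \<delta> / (2 * pi)) / s)
      - expectation (\<lambda>\<omega>. max 0 (l - X K \<omega>)) - s * \<delta> - c - 3 * real K * \<delta>\<^sup>2 / c ^ 3
    \<le> s * expectation (\<lambda>\<omega>. \<bar>f (sample_path (obs e s) \<omega>) - stop \<omega>\<bar>)"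
proof -
  let ?Y = "sample_path (obs e s)" and ?b = "\<lambda>\<omega>. B (real m * \<delta>) \<omega> - B 0 \<omega>"
  let ?L = "\<lambda>\<omega>. \<Sum>i<m. D i \<omega> * (1 - alive i \<omega>)" and ?R = "\<lambda>\<omega>. \<Sum>i\<in>{m..<K}. D i \<omega> * (alive i \<omega> * S \<omega>)"
  let ?O = "\<lambda>\<omega>. max 0 (l - X K \<omega>) + s * \<delta> + c + (\<Sum>i<K. D i \<omega> ^ 4) / c ^ 3"
  have md: "0 < real m * \<delta>" using m \<delta> by simp
  have f_int: "integrable M (\<lambda>\<omega>. f (?Y \<omega>))"
    by (rule integrable_const_bound[of _ b]) (use bound in auto)
  have S_int: "integrable M (\<lambda>\<omega>. g \<omega> * S \<omega>)" if "integrable M g" for g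
    by (rule Bochner_Integration.integrable_bound[OF that])
      (use that S_bound in \<open>auto simp: abs_mult mult_left_le\<close>)
  have b_int: "integrable M (\<lambda>\<omega>. ?b \<omega> * S \<omega>)"
    by (rule S_int[OF B.integrable_increment[OF order_refl md]])
  have aS: "\<bar>alive i \<omega> * S \<omega>\<bar> \<le> 1" for i \<omega>
    using alive_bounds[of i \<omega>] S_bound[of \<omega>] by (simp add: abs_mult mult_le_one)
  \<comment> \<open>From index m on, S belongs to \<open>past i\<close>, so it can be paired with a
    centred increment. Before m it does not, and there the increments are bounded in absolute value
    instead.\<close>
  have R_term: "integrable M (\<lambda>\<omega>. D i \<omega> * (alive i \<omega> * S \<omega>))"
    "expectation (\<lambda>\<omega>. D i \<omega> * (alive i \<omega> * S \<omega>)) = 0" if "i \<in> {m..<K}" for i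
    using that aS
    by (intro integrable_D_times_past[where b=1] expectation_D_times_past[where b=1]
        borel_measurable_times alive_past S_past; simp)+
  have R_int: "integrable M ?R"
    by (intro Bochner_Integration.integrable_sum R_term)
  have R_exp: "expectation ?R = 0"
    using R_term by (subst Bochner_Integration.integral_sum) auto
  have L_int: "integrable M ?L" by (rule integrable_increments_lost)
  have D4: "integrable M (\<lambda>\<omega>. D i \<omega> ^ 4)" "expectation (\<lambda>\<omega>. D i \<omega> ^ 4) = 3 * \<delta>\<^sup>2" for i
    using B.integrable_increment_power4[of "real i * \<delta>" "real (Suc i) * \<delta>"]
      B.expectation_increment_power4[of "real i * \<delta>" "real (Suc i) * \<delta>"] \<delta>
    unfolding D_def by (auto simp: algebra_simps)
  have X_int: "integrable M (\<lambda>\<omega>. max 0 (l - X K \<omega>))"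
    using integrable_X by (intro integrable_max Bochner_Integration.integrable_diff) auto
  have O_int: "integrable M ?O"
    using X_int D4 by auto
  have D4_exp: "expectation (\<lambda>\<omega>. (\<Sum>i<K. D i \<omega> ^ 4) / c ^ 3) = 3 * real K * \<delta>\<^sup>2 / c ^ 3"
    using D4 by (simp add: Bochner_Integration.integral_sum)
  have O_exp: "expectation ?O = expectation (\<lambda>\<omega>. max 0 (l - X K \<omega>)) + s * \<delta> + c + 3 * real K * \<delta>\<^sup>2 / c ^ 3"
    using X_int D4 by (simp add: prob_space D4_exp[simplified])
  \<comment> \<open>A pointwise lower bound of s |f - stop| whose mean can be estimated; |L| and O
    absorb L S and (Z K - l) S.\<close>
  let ?G = "\<lambda>\<omega>. s * (f (?Y \<omega>) * S \<omega>) + ?b \<omega> * S \<omega> - \<bar>?L \<omega>\<bar> + ?R \<omega> - ?O \<omega> - l * S \<omega>"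
  have S_exp: "expectation S = 0" and fS_exp: "expectation (\<lambda>\<omega>. f (?Y \<omega>) * S \<omega>) = 0"
    using expectation_sgn_orth[OF e, of "real m * \<delta>"] expectation_path_times_sgn[OF f bound e, of "real m * \<delta>" s] md
    by (simp_all add: S_def[abs_def])
  have "integrable M S"
    using S_int[of "\<lambda>_. 1"] by simp
  note ints = this S_int[OF f_int] b_int L_int R_int O_int
  have "expectation ?G = expectation (\<lambda>\<omega>. ?b \<omega> * S \<omega>) - expectation (\<lambda>\<omega>. \<bar>?L \<omega>\<bar>) - expectation ?O"
    using ints R_exp S_exp fS_exp by simp
  also have "\<dots> \<ge> sqrt (2 * (real m * \<delta>) * e\<^sup>2 / (pi * (1 + e\<^sup>2)))
      - sqrt (2 / pi) * sqrt (sqrt (real m * \<delta> / (2 * pi)) / s) - expectation ?O"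
    using expectation_increments_lost expectation_increment_times_sgn_orth[OF e md] by (simp add: S_def)
  finally have "sqrt (2 * (real m * \<delta>) * e\<^sup>2 / (pi * (1 + e\<^sup>2)))
      - sqrt (2 / pi) * sqrt (sqrt (real m * \<delta> / (2 * pi)) / s) - expectation ?O \<le> expectation ?G" .
  also have "expectation ?G \<le> expectation (\<lambda>\<omega>. s * \<bar>f (?Y \<omega>) - stop \<omega>\<bar>)"
  proof (rule integral_mono)
    show "integrable M ?G"
      using ints by simp
    show "integrable M (\<lambda>\<omega>. s * \<bar>f (?Y \<omega>) - stop \<omega>\<bar>)"
      using f_int rv_stop stop_bounds
      by (auto intro!: Bochner_Integration.integrable_diff integrable_const_bound[of stop "\<delta> * K"])
    fix \<omega>
    have S1: "x * S \<omega> \<le> \<bar>x\<bar>" for x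
      using S_bound[of \<omega>] mult_left_le[of "\<bar>S \<omega>\<bar>" "\<bar>x\<bar>"] abs_ge_self[of "x * S \<omega>"] by (simp add: abs_mult)
    have "?G \<omega> = s * (f (?Y \<omega>) - stop \<omega>) * S \<omega> + (Z K \<omega> - l) * S \<omega> + ?L \<omega> * S \<omega> - \<bar>?L \<omega>\<bar> - ?O \<omega>"
    proof -
      have "?R \<omega> = (\<Sum>i\<in>{m..<K}. D i \<omega> * alive i \<omega>) * S \<omega>"
        by (simp add: sum_distrib_right mult.assoc)
      moreover have "s * (f (?Y \<omega>) - stop \<omega>) * S \<omega> = s * (f (?Y \<omega>) * S \<omega>) - (s * stop \<omega>) * S \<omega>"
        by (simp add: algebra_simps)
      ultimately show ?thesis
        unfolding time_stop by (simp add: ring_distribs)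
    qed
    also have "\<dots> \<le> s * (f (?Y \<omega>) - stop \<omega>) * S \<omega>"
      using S1[of "Z K \<omega> - l"] S1[of "?L \<omega>"] Z_dist_level[OF c, of \<omega>] by linarith
    also have "\<dots> \<le> s * \<bar>f (?Y \<omega>) - stop \<omega>\<bar>"
      using s S1[of "s * (f (?Y \<omega>) - stop \<omega>)"] by (simp add: abs_mult)
    finally show "?G \<omega> \<le> s * \<bar>f (?Y \<omega>) - stop \<omega>\<bar>" .
  qed
  finally show ?thesis
    unfolding O_exp by simp
qed

end

subsection \<open>Dyadic refinement of the grid\<close>

text \<open>\<open>stop\<close> as a functional of a single path, so that refining the grid becomes
  a deterministic question.\<close>

definition grid_stop :: "(real \<Rightarrow> real) \<Rightarrow> real \<Rightarrow> real \<Rightarrow> nat \<Rightarrow> real" where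
  "grid_stop x l \<delta> K = \<delta> * (\<Sum>i<K. \<Prod>j\<le>i. of_bool (x (real j * \<delta>) < l))"

lemma grid_stop_nonneg: "0 \<le> \<delta> \<Longrightarrow> 0 \<le> grid_stop x l \<delta> K"
  unfolding grid_stop_def by (intro mult_nonneg_nonneg sum_nonneg prod_nonneg) auto

lemma grid_stop_mono:
  assumes "0 \<le> \<delta>" "l \<le> l'"
  shows "grid_stop x l \<delta> K \<le> grid_stop x l' \<delta> K"
  unfolding grid_stop_def using assms by (intro mult_left_mono sum_mono prod_mono) auto

text \<open>With \<open>grid_stop_hits\<close> this characterises the count: it gives the least grid
  time that is the horizon or has x at least l.\<close>

lemma grid_stop_le:
  assumes \<delta>: "0 \<le> \<delta>" and j: "j \<le> K" "j = K \<or> l \<le> x (real j * \<delta>)"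
  shows "grid_stop x l \<delta> K \<le> real j * \<delta>"
proof -
  have "(\<Prod>j\<le>i. of_bool (x (real j * \<delta>) < l)) \<le> (of_bool (i < j) :: real)" if "i < K" for i
  proof (cases "i < j")
    case True
    have "(\<Prod>j\<le>i. of_bool (x (real j * \<delta>) < l)) \<le> (1 :: real)"
      by (rule prod_le_1) auto
    with True show ?thesis by (simp only: of_bool_def if_True)
  next
    case False
    then have "l \<le> x (real j * \<delta>)" "j \<le> i" using j that by auto
    then have "(\<Prod>j\<le>i. of_bool (x (real j * \<delta>) < l)) = (0 :: real)"
      by (intro prod_zero) (auto intro!: bexI[of _ j])
    then show ?thesis by (simp only: of_bool_def) simp
  qed
  then have "(\<Sum>i<K. \<Prod>j\<le>i. of_bool (x (real j * \<delta>) < l)) \<le> (\<Sum>i<K. of_bool (i < j) :: real)"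
    by (intro sum_mono) simp
  also have "\<dots> = real (card ({..<K} \<inter> {..<j}))"
    by (simp add: lessThan_def)
  also have "{..<K} \<inter> {..<j} = {..<j}" using j by auto
  finally show ?thesis
    unfolding grid_stop_def using \<delta> by (simp add: mult.commute mult_left_mono)
qed

lemma grid_stop_hits:
  assumes \<delta>: "0 < \<delta>"
  shows "\<exists>j\<le>K. grid_stop x l \<delta> K = real j * \<delta> \<and> (j = K \<or> l \<le> x (real j * \<delta>))"
proof (induction K)
  case (Suc K)
  then obtain j where j: "j \<le> K" "grid_stop x l \<delta> K = real j * \<delta>" "j = K \<or> l \<le> x (real j * \<delta>)"
    by blast
  let ?p = "\<Prod>j\<le>K. of_bool (x (real j * \<delta>) < l) :: real"
  have Suc: "grid_stop x l \<delta> (Suc K) = grid_stop x l \<delta> K + \<delta> * ?p"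
    by (simp add: grid_stop_def distrib_left)
  show ?case
  proof (cases "l \<le> x (real j * \<delta>)")
    case True
    then have "?p = 0" using j(1) by (intro prod_zero) (auto intro!: bexI[of _ j])
    with True j Suc show ?thesis by (intro exI[of _ j]) auto
  next
    case False
    with j have jK: "j = K" by simp
    \<comment> \<open>An earlier grid time at or above l would, by \<open>grid_stop_le\<close>, push
      the stop below its value \<open>real K * \<delta>\<close>.\<close>
    have "x (real i * \<delta>) < l" if i: "i \<le> K" for i
    proof (rule ccontr)
      assume "\<not> x (real i * \<delta>) < l"
      moreover from this have "i \<noteq> K" using False jK by auto
      ultimately have "real K * \<delta> \<le> real i * \<delta>" "i < K"
        using grid_stop_le[of \<delta> i K l x] i j jK \<delta> by auto
      then show False using \<delta> by simp
    qed
    then have "?p = 1" by (intro prod.neutral) auto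
    with j jK Suc show ?thesis by (intro exI[of _ "Suc K"]) (simp add: distrib_right)
  qed
qed (simp add: grid_stop_def)

section \<open>Nested dyadic grids on a fixed horizon\<close>

context
  fixes n :: real and R :: nat
  assumes n: "0 < n"
begin

text \<open>The horizon R n stays fixed while the mesh halves, so the grids are nested, and n is
  exactly 2^k mesh widths at stage k.\<close>

definition dyadic_stop :: "(real \<Rightarrow> real) \<Rightarrow> real \<Rightarrow> nat \<Rightarrow> real" where
  "dyadic_stop x l k = grid_stop x l (n / 2 ^ k) (R * 2 ^ k)"

text \<open>For a continuous path this lies, up to the horizon, between the first times of x \<ge> l
  and of x > l. The two may differ: a path can touch l between grid points without exceeding
  it.\<close>

definition limit_stop :: "(real \<Rightarrow> real) \<Rightarrow> real \<Rightarrow> real" where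
  "limit_stop x l = (INF k. dyadic_stop x l k)"

lemma dyadic_stop_nonneg: "0 \<le> dyadic_stop x l k"
  unfolding dyadic_stop_def using n by (intro grid_stop_nonneg) simp

lemma dyadic_stop_le: "dyadic_stop x l k \<le> real R * n"
  using grid_stop_le[of "n / 2 ^ k" "R * 2 ^ k" "R * 2 ^ k" l x] n by (simp add: dyadic_stop_def)

lemma dyadic_stop_hits: "dyadic_stop x l k < real R * n \<Longrightarrow> l \<le> x (dyadic_stop x l k)"
  using grid_stop_hits[of "n / 2 ^ k" "R * 2 ^ k" x l] n by (auto simp: dyadic_stop_def)

lemma decseq_dyadic_stop: "decseq (dyadic_stop x l)"
proof (rule decseq_SucI)
  fix k
  obtain j where j: "j \<le> R * 2 ^ k" "dyadic_stop x l k = real j * (n / 2 ^ k)"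
    "j = R * 2 ^ k \<or> l \<le> x (real j * (n / 2 ^ k))"
    using grid_stop_hits[of "n / 2 ^ k" "R * 2 ^ k" x l] n by (auto simp: dyadic_stop_def)
  \<comment> \<open>Coarse index j is fine index 2 j, so the coarse stop is a candidate on the finer
    grid.\<close>
  have "grid_stop x l (n / 2 ^ Suc k) (R * 2 ^ Suc k) \<le> real (2 * j) * (n / 2 ^ Suc k)"
    using n j by (intro grid_stop_le) auto
  then show "dyadic_stop x l (Suc k) \<le> dyadic_stop x l k"
    using j(2) by (simp add: dyadic_stop_def)
qed

lemma bdd_below_dyadic_stop: "bdd_below (range (dyadic_stop x l))"
  using dyadic_stop_nonneg by (intro bdd_belowI[of _ 0]) auto

lemma dyadic_stop_tendsto: "dyadic_stop x l \<longlonglongrightarrow> limit_stop x l"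
  unfolding limit_stop_def by (rule LIMSEQ_decseq_INF[OF bdd_below_dyadic_stop decseq_dyadic_stop])

lemma limit_stop_le_dyadic_stop: "limit_stop x l \<le> dyadic_stop x l k"
  unfolding limit_stop_def by (rule cINF_lower[OF bdd_below_dyadic_stop]) simp

lemma limit_stop_bounds: "0 \<le> limit_stop x l" "limit_stop x l \<le> real R * n"
proof -
  show "0 \<le> limit_stop x l"
    unfolding limit_stop_def by (rule cINF_greatest) (auto simp: dyadic_stop_nonneg)
  show "limit_stop x l \<le> real R * n"
    using limit_stop_le_dyadic_stop[of x l 0] dyadic_stop_le[of x l 0] by linarith
qed

lemma limit_stop_mono: "l \<le> l' \<Longrightarrow> limit_stop x l \<le> limit_stop x l'"
proof -
  assume "l \<le> l'"
  then have "dyadic_stop x l k \<le> dyadic_stop x l' k" for k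
    unfolding dyadic_stop_def using n by (intro grid_stop_mono) auto
  then show ?thesis
    by (intro LIMSEQ_le[OF dyadic_stop_tendsto dyadic_stop_tendsto]) auto
qed

lemma limit_stop_hits:
  assumes x: "continuous_on {0..} x" and less: "limit_stop x l < real R * n"
  shows "l \<le> x (limit_stop x l)"
proof -
  have "(\<lambda>k. x (dyadic_stop x l k)) \<longlonglongrightarrow> x (limit_stop x l)"
    by (rule continuous_on_tendsto_compose[OF x dyadic_stop_tendsto])
      (auto simp: limit_stop_bounds dyadic_stop_nonneg)
  moreover have "eventually (\<lambda>k. l \<le> x (dyadic_stop x l k)) sequentially"
    using order_tendstoD(2)[OF dyadic_stop_tendsto less] by eventually_elim (rule dyadic_stop_hits)
  ultimately show ?thesis
    by (rule tendsto_lowerbound) simp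
qed

text \<open>By continuity x stays above l shortly after u, so every fine enough grid has a point
  there. Reaching l at u without exceeding it would not suffice.\<close>

lemma limit_stop_le:
  assumes x: "continuous_on {0..} x" and u: "0 \<le> u" "l < x u"
  shows "limit_stop x l \<le> u"
proof (cases "u < real R * n")
  case True
  show ?thesis
  proof (rule field_le_epsilon)
    fix \<eta> :: real assume \<eta>: "0 < \<eta>"
    obtain d where d: "0 < d" "\<And>v. v \<in> {0..} \<Longrightarrow> dist v u < d \<Longrightarrow> dist (x v) (x u) < x u - l"
      using x u unfolding continuous_on_iff by (metis atLeast_iff diff_gt_0_iff_gt)
    have "(\<lambda>k. n / 2 ^ k) \<longlonglongrightarrow> 0" by real_asymp
    from order_tendstoD(2)[OF this, of "min d \<eta>"] d \<eta>
    obtain k where k: "n / 2 ^ k < d" "n / 2 ^ k < \<eta>"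
      by (auto simp: eventually_sequentially)
    define \<delta> where "\<delta> = n / 2 ^ k"
    have \<delta>: "0 < \<delta>" using n by (simp add: \<delta>_def)
    \<comment> \<open>The first grid point at or after u: less than one mesh width away, and not
      beyond the horizon, which is itself a grid point.\<close>
    define j where "j = nat \<lceil>u / \<delta>\<rceil>"
    have "real j = of_int \<lceil>u / \<delta>\<rceil>" using u \<delta> by (simp add: j_def)
    then have "u / \<delta> \<le> real j" "real j < u / \<delta> + 1" by linarith+
    then have j: "u \<le> real j * \<delta>" "real j * \<delta> < u + \<delta>" using \<delta> by (simp_all add: field_simps)
    have Rn: "real R * n = real (R * 2 ^ k) * \<delta>" by (simp add: \<delta>_def)
    from True have "u \<le> real (R * 2 ^ k) * \<delta>" unfolding Rn by simp
    then have "u / \<delta> \<le> real (R * 2 ^ k)" using \<delta> by (simp only: pos_divide_le_eq)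
    then have "\<lceil>u / \<delta>\<rceil> \<le> int (R * 2 ^ k)" by (simp add: ceiling_le_iff)
    then have jK: "j \<le> R * 2 ^ k" by (simp add: j_def nat_le_iff)
    have "dist (x (real j * \<delta>)) (x u) < x u - l"
      using j u k \<delta> by (intro d) (auto simp: dist_real_def \<delta>_def)
    then have "l \<le> x (real j * \<delta>)" by (auto simp: dist_real_def)
    then have "dyadic_stop x l k \<le> real j * \<delta>"
      unfolding dyadic_stop_def \<delta>_def[symmetric] using jK \<delta> by (intro grid_stop_le) auto
    then show "limit_stop x l \<le> u + \<eta>"
      using limit_stop_le_dyadic_stop[of x l k] j k by (simp add: \<delta>_def)
  qed
next
  case False
  then show ?thesis using limit_stop_bounds(2)[of x l] by linarith
qed

text \<open>Levels strictly below l close the gap between reaching and exceeding: a time that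
  reaches l exceeds every L j, and h reaches l by continuity if it is before the horizon. So h is
  the hitting time of l, cut at the horizon.\<close>

lemma limit_stop_levels:
  assumes x: "continuous_on {0..} x" and L: "incseq L" "L \<longlonglongrightarrow> l" "\<And>j. L j < l"
    and lim: "(\<lambda>j. limit_stop x (L j)) \<longlonglongrightarrow> h"
  shows "0 \<le> h" "h \<le> real R * n" "\<And>u. 0 \<le> u \<Longrightarrow> l \<le> x u \<Longrightarrow> h \<le> u"
    and "h < real R * n \<Longrightarrow> l \<le> x h"
proof -
  show h: "0 \<le> h" "h \<le> real R * n"
    using LIMSEQ_le_const[OF lim, of 0] LIMSEQ_le_const2[OF lim, of "real R * n"] limit_stop_bounds by auto
  show "h \<le> u" if "0 \<le> u" "l \<le> x u" for u
    using LIMSEQ_le_const2[OF lim, of u] limit_stop_le[OF x that(1)] that(2) L(3) less_le_trans by blast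
  show "l \<le> x h" if less: "h < real R * n"
  proof (rule LIMSEQ_le[OF L(2)])
    show "(\<lambda>j. x (limit_stop x (L j))) \<longlonglongrightarrow> x h"
      by (rule continuous_on_tendsto_compose[OF x lim]) (auto simp: h limit_stop_bounds)
    have "limit_stop x (L j) \<le> h" for j
      by (rule incseq_le[OF _ lim]) (auto intro!: incseq_SucI limit_stop_mono incseq_SucD[OF L(1)])
    then have "L j \<le> x (limit_stop x (L j))" for j
      using less by (intro limit_stop_hits[OF x]) (rule le_less_trans)
    then show "\<exists>N. \<forall>j\<ge>N. L j \<le> x (limit_stop x (L j))" by blast
  qed
qed

end

subsection \<open>The limit of vanishing mesh\<close>

context wiener_pair
begin

definition drift_path :: "real \<Rightarrow> 'a \<Rightarrow> real \<Rightarrow> real" where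
  "drift_path s \<omega> u = B u \<omega> - B 0 \<omega> + s * u"

lemma (in stopped_walk) stop_eq_grid_stop: "stop \<omega> = grid_stop (drift_path s \<omega>) l \<delta> K"
  by (simp add: stop_def alive_def X_def grid_stop_def drift_path_def)

text \<open>The mesh is refined with c held fixed, and c tends to 0 afterwards, because the
  remainder from the fourth moments is of order mesh / c^3.\<close>

lemma
  fixes f :: "(real \<Rightarrow> real) \<Rightarrow> real"
  assumes f: "f \<in> borel_measurable path_space" and bound: "\<And>w. \<bar>f w\<bar> \<le> b"
    and e: "0 < e" and s: "0 < s" and n: "0 < n" and l: "s * n \<le> l" and R: "2 \<le> R"
  shows borel_measurable_limit_stop: "(\<lambda>\<omega>. limit_stop n R (drift_path s \<omega>) l) \<in> borel_measurable M"
    and expectation_limit_stop_error: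
      "sqrt (2 * n * e\<^sup>2 / (pi * (1 + e\<^sup>2))) - sqrt (2 / pi) * sqrt (sqrt (n / (2 * pi)) / s)
        - expectation (\<lambda>\<omega>. max 0 (l - drift_path s \<omega> (real R * n)))
      \<le> s * expectation (\<lambda>\<omega>. \<bar>f (sample_path (obs e s) \<omega>) - limit_stop n R (drift_path s \<omega>) l\<bar>)"
      (is "?C \<le> s * expectation ?g")
proof -
  note [measurable] = f
  let ?d = "\<lambda>k \<omega>. dyadic_stop n R (drift_path s \<omega>) l k"
  have W: "stopped_walk M B N e s (n / 2 ^ k) l (2 ^ k) (R * 2 ^ k)" for k
  proof -
    have "0 < s * n" using s n by simp
    then have "0 < l" using l by linarith
    with R show ?thesis
      by (intro stopped_walk.intro wiener_pair_axioms stopped_walk_axioms.intro) (use e s n l in simp_all)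
  qed
  have d_meas [measurable]: "?d k \<in> borel_measurable M" for k
  proof -
    interpret stopped_walk M B N e s "n / 2 ^ k" l "2 ^ k" "R * 2 ^ k" by (rule W)
    show ?thesis
      using rv_stop by (simp add: stop_eq_grid_stop[abs_def] dyadic_stop_def[OF n])
  qed
  show H_meas [measurable]: "(\<lambda>\<omega>. limit_stop n R (drift_path s \<omega>) l) \<in> borel_measurable M"
    by (rule borel_measurable_LIMSEQ_real[OF dyadic_stop_tendsto[OF n] d_meas])
  have C: "?C - c \<le> s * expectation ?g" if c: "0 < c" for c
  proof (rule LIMSEQ_le)
    show "(\<lambda>k. s * expectation (\<lambda>\<omega>. \<bar>f (sample_path (obs e s) \<omega>) - ?d k \<omega>\<bar>)) \<longlonglongrightarrow> s * expectation ?g"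
    proof (intro tendsto_mult tendsto_const integral_dominated_convergence[where w="\<lambda>_. b + real R * n"])
      show "AE \<omega> in M. (\<lambda>k. \<bar>f (sample_path (obs e s) \<omega>) - ?d k \<omega>\<bar>) \<longlonglongrightarrow> ?g \<omega>"
        by (intro AE_I2 tendsto_intros dyadic_stop_tendsto n)
      show "AE \<omega> in M. norm \<bar>f (sample_path (obs e s) \<omega>) - ?d k \<omega>\<bar> \<le> b + real R * n" for k
      proof (rule AE_I2)
        fix \<omega>
        show "norm \<bar>f (sample_path (obs e s) \<omega>) - ?d k \<omega>\<bar> \<le> b + real R * n"
          using bound[of "sample_path (obs e s) \<omega>"] dyadic_stop_nonneg[OF n, of R "drift_path s \<omega>" l k]
            dyadic_stop_le[OF n, of R "drift_path s \<omega>" l k] by (simp add: abs_le_iff)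
      qed
    qed auto
    let ?r = "\<lambda>k. ?C - c - (s * (n / 2 ^ k) + 3 * real R * n * (n / 2 ^ k) / c ^ 3)"
    have "(\<lambda>k. n / 2 ^ k) \<longlonglongrightarrow> 0"
      using n by real_asymp
    then have "?r \<longlonglongrightarrow> ?C - c - (s * 0 + 3 * real R * n * 0 / c ^ 3)"
      using c by (intro tendsto_intros) auto
    then show "?r \<longlonglongrightarrow> ?C - c" by simp
    have "?r k \<le> s * expectation (\<lambda>\<omega>. \<bar>f (sample_path (obs e s) \<omega>) - ?d k \<omega>\<bar>)" for k
    proof -
      interpret stopped_walk M B N e s "n / 2 ^ k" l "2 ^ k" "R * 2 ^ k" by (rule W)
      have "X (R * 2 ^ k) \<omega> = drift_path s \<omega> (real R * n)" for \<omega>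
        by (simp add: X_def drift_path_def)
      moreover have "3 * real (R * 2 ^ k) * (n / 2 ^ k)\<^sup>2 = 3 * real R * n * (n / 2 ^ k)"
        by (simp add: power2_eq_square)
      ultimately show ?thesis
        using expectation_estimation_error[OF f bound c]
        by (simp add: stop_eq_grid_stop[abs_def] dyadic_stop_def[OF n] algebra_simps)
    qed
    then show "\<exists>N. \<forall>k\<ge>N. ?r k \<le> s * expectation (\<lambda>\<omega>. \<bar>f (sample_path (obs e s) \<omega>) - ?d k \<omega>\<bar>)"
      by blast
  qed
  show "?C \<le> s * expectation ?g"
  proof (rule field_le_epsilon)
    fix c :: real assume "0 < c"
    from C[OF this] show "?C \<le> s * expectation ?g + c"
      by (simp only: diff_le_eq)
  qed
qed

text \<open>A walk below l at time T needs B to fall by more than the distance s T - l from the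
  level to its mean. The fourth moment 3 T^2 against the cube of that distance vanishes as T
  grows.\<close>

lemma expectation_level_gap:
  assumes T: "0 < T" and sT: "l < s * T"
  shows "expectation (\<lambda>\<omega>. max 0 (l - drift_path s \<omega> T)) \<le> 3 * T\<^sup>2 / (s * T - l) ^ 3"
    and "integrable M (\<lambda>\<omega>. max 0 (l - drift_path s \<omega> T))"
proof -
  let ?b = "\<lambda>\<omega>. B T \<omega> - B 0 \<omega>" and ?a = "s * T - l"
  have a: "0 < ?a" using sT by simp
  have le: "max 0 (l - drift_path s \<omega> T) \<le> ?b \<omega> ^ 4 / ?a ^ 3" for \<omega>
  proof -
    have "(- ?b \<omega>) ^ 4 = ?b \<omega> ^ 4" by (subst power_minus) simp
    with le_add_power4[OF a, of "- ?b \<omega>"] have "- ?b \<omega> \<le> ?a + ?b \<omega> ^ 4 / ?a ^ 3" by (simp only:)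
    moreover have "0 \<le> ?b \<omega> ^ 4 / ?a ^ 3" using a by (intro divide_nonneg_nonneg) auto
    ultimately show ?thesis
      unfolding drift_path_def by (intro max.boundedI) linarith+
  qed
  show "integrable M (\<lambda>\<omega>. max 0 (l - drift_path s \<omega> T))"
  proof -
    have "integrable M (\<lambda>\<omega>. l - s * T - ?b \<omega>)"
      by (rule Bochner_Integration.integrable_diff[OF integrable_const B.integrable_increment[OF order_refl T]])
    moreover have "l - drift_path s \<omega> T = l - s * T - ?b \<omega>" for \<omega>
      by (simp add: drift_path_def)
    ultimately show ?thesis by (simp only:) (intro integrable_max integrable_const)
  qed
  then have "expectation (\<lambda>\<omega>. max 0 (l - drift_path s \<omega> T)) \<le> expectation (\<lambda>\<omega>. ?b \<omega> ^ 4 / ?a ^ 3)"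
    using B.integrable_increment_power4[OF order_refl T] by (intro integral_mono le) auto
  also have "\<dots> = 3 * T\<^sup>2 / ?a ^ 3"
    using B.expectation_increment_power4[OF order_refl T] by simp
  finally show "expectation (\<lambda>\<omega>. max 0 (l - drift_path s \<omega> T)) \<le> 3 * T\<^sup>2 / (s * T - l) ^ 3" .
qed

lemma AE_drift_path_continuous: "AE \<omega> in M. continuous_on {0..} (drift_path s \<omega>)"
  using B.continuous_paths
proof eventually_elim
  case (elim \<omega>)
  then show ?case
    unfolding drift_path_def[abs_def] by (intro continuous_intros)
qed

text \<open>The error of \<open>\<eta>\<close> is compared with that of \<open>\<eta>\<close> clipped to \<open>[0, R n]\<close>, for the hitting time
  stopped at \<open>R n\<close>: clipping does not increase distances, and nothing need be integrable.\<close>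

lemma mean_abs_error_clipped:
  fixes \<eta> :: "(real \<Rightarrow> real) \<Rightarrow> real"
  assumes \<eta> [measurable]: "\<eta> \<in> borel_measurable path_space"
    and e: "0 < e" and s: "0 < s" and n: "0 < n" and l: "s * n < l" and R: "2 \<le> R" "l < s * (real R * n)"
  shows "ennreal ((sqrt (2 * n * e\<^sup>2 / (pi * (1 + e\<^sup>2))) - sqrt (2 / pi) * sqrt (sqrt (n / (2 * pi)) / s)
        - 3 * (real R * n)\<^sup>2 / (s * (real R * n) - l) ^ 3) / s)
      \<le> mean_abs_error M (obs e s) (hitting_time (\<lambda>u \<omega>. drift_path s \<omega> u) l) \<eta>"
    (is "ennreal (?C / s) \<le> _")
proof -
  let ?T = "real R * n"
  have T: "0 < ?T" using R n by simp
  define f where "f w = max 0 (min ?T (\<eta> w))" for w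
  have f [measurable]: "f \<in> borel_measurable path_space"
    unfolding f_def by measurable
  have f_bound: "\<bar>f w\<bar> \<le> ?T" for w using T by (simp add: f_def)
  \<comment> \<open>Levels increasing strictly to l, as \<open>limit_stop_levels\<close> asks; L 0 =
    s n, so each L j satisfies the condition s n \<le> L j of the grid bound.\<close>
  define L where "L j = l - (l - s * n) / real (Suc j)" for j
  have L_less: "L j < l" and L_ge: "s * n \<le> L j" for j
  proof -
    show "L j < l" using l by (simp add: L_def)
    have "(l - s * n) / real (Suc j) \<le> (l - s * n) / 1"
      using l by (intro divide_left_mono) auto
    then show "s * n \<le> L j" by (simp add: L_def)
  qed
  have L_inc: "incseq L"
    unfolding L_def using l by (intro incseq_SucI diff_left_mono divide_left_mono) auto
  have L_lim: "L \<longlonglongrightarrow> l"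
    unfolding L_def by real_asymp
  let ?G = "\<lambda>j \<omega>. limit_stop n R (drift_path s \<omega>) (L j)"
  define h where "h \<omega> = (SUP j. ?G j \<omega>)" for \<omega>
  have h_lim: "(\<lambda>j. ?G j \<omega>) \<longlonglongrightarrow> h \<omega>" for \<omega>
    unfolding h_def
  proof (rule LIMSEQ_incseq_SUP)
    show "bdd_above (range (\<lambda>j. ?G j \<omega>))"
      using limit_stop_bounds(2)[OF n] by (intro bdd_aboveI[of _ ?T]) auto
    show "incseq (\<lambda>j. ?G j \<omega>)"
      by (rule incseq_SucI, rule limit_stop_mono[OF n], rule incseq_SucD[OF L_inc])
  qed
  have G_meas [measurable]: "?G j \<in> borel_measurable M" for j
    by (rule borel_measurable_limit_stop[OF f f_bound e s n L_ge R(1)])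
  have h_meas [measurable]: "h \<in> borel_measurable M"
    by (rule borel_measurable_LIMSEQ_real[OF h_lim G_meas])
  let ?g = "\<lambda>\<omega>. \<bar>f (sample_path (obs e s) \<omega>) - h \<omega>\<bar>"
  have h_bounds: "0 \<le> h \<omega>" "h \<omega> \<le> ?T" for \<omega>
    using LIMSEQ_le_const[OF h_lim, where a=0] LIMSEQ_le_const2[OF h_lim, where a="?T"] limit_stop_bounds[OF n] by auto
  have "?C \<le> s * expectation ?g"
  proof (rule LIMSEQ_le_const)
    show "(\<lambda>j. s * expectation (\<lambda>\<omega>. \<bar>f (sample_path (obs e s) \<omega>) - ?G j \<omega>\<bar>)) \<longlonglongrightarrow> s * expectation ?g"
    proof (intro tendsto_mult tendsto_const integral_dominated_convergence[where w="\<lambda>_. ?T + ?T"])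
      show "AE \<omega> in M. (\<lambda>j. \<bar>f (sample_path (obs e s) \<omega>) - ?G j \<omega>\<bar>) \<longlonglongrightarrow> ?g \<omega>"
        by (intro AE_I2 tendsto_intros h_lim)
      show "AE \<omega> in M. norm \<bar>f (sample_path (obs e s) \<omega>) - ?G j \<omega>\<bar> \<le> ?T + ?T" for j
      proof (rule AE_I2)
        fix \<omega>
        show "norm \<bar>f (sample_path (obs e s) \<omega>) - ?G j \<omega>\<bar> \<le> ?T + ?T"
          using f_bound[of "sample_path (obs e s) \<omega>"] limit_stop_bounds[OF n, of R "drift_path s \<omega>" "L j"]
          unfolding real_norm_def by linarith
      qed
    qed auto
    have "?C \<le> s * expectation (\<lambda>\<omega>. \<bar>f (sample_path (obs e s) \<omega>) - ?G j \<omega>\<bar>)" for j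
    proof -
      have "L j < s * ?T" using L_less[of j] R by simp
      note gap = expectation_level_gap[OF T R(2)] expectation_level_gap(2)[OF T this]
      have "expectation (\<lambda>\<omega>. max 0 (L j - drift_path s \<omega> ?T)) \<le> expectation (\<lambda>\<omega>. max 0 (l - drift_path s \<omega> ?T))"
        using L_less[of j] by (intro integral_mono gap) auto
      with gap(1) expectation_limit_stop_error[OF f f_bound e s n L_ge R(1), of j] show ?thesis
        by simp
    qed
    then show "\<exists>N. \<forall>j\<ge>N. ?C \<le> s * expectation (\<lambda>\<omega>. \<bar>f (sample_path (obs e s) \<omega>) - ?G j \<omega>\<bar>)"
      by blast
  qed
  then have "?C / s \<le> expectation ?g" using s by (simp add: field_simps)
  then have "ennreal (?C / s) \<le> ennreal (expectation ?g)" by (rule ennreal_leI)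
  also have "\<dots> = (\<integral>\<^sup>+\<omega>. ennreal (?g \<omega>) \<partial>M)"
  proof (rule nn_integral_eq_integral[symmetric])
    show "integrable M ?g"
    proof (rule integrable_const_bound[of _ "?T + ?T"])
      show "AE \<omega> in M. norm (?g \<omega>) \<le> ?T + ?T"
      proof (rule AE_I2)
        fix \<omega>
        show "norm (?g \<omega>) \<le> ?T + ?T"
          using f_bound[of "sample_path (obs e s) \<omega>"] h_bounds[of \<omega>]
          unfolding real_norm_def by linarith
      qed
    qed measurable
  qed simp
  also have "\<dots> \<le> mean_abs_error M (obs e s) (hitting_time (\<lambda>u \<omega>. drift_path s \<omega> u) l) \<eta>"
    unfolding mean_abs_error_def
  proof (rule nn_integral_mono_AE, use AE_drift_path_continuous[of s] in eventually_elim)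
    fix \<omega> assume x: "continuous_on {0..} (drift_path s \<omega>)"
    note hit = limit_stop_levels[OF n x L_inc L_lim L_less h_lim]
    let ?\<tau> = "hitting_time (\<lambda>u \<omega>. drift_path s \<omega> u) l \<omega>" and ?\<eta> = "\<eta> (sample_path (obs e s) \<omega>)"
    have h_le: "ereal (h \<omega>) \<le> ?\<tau>"
      unfolding hitting_time_def using hit(3) by (intro INF_greatest) auto
    have "ereal (?g \<omega>) \<le> \<bar>ereal ?\<eta> - ?\<tau>\<bar>"
    proof (cases "?\<tau>")
      case (real r)
      \<comment> \<open>Before the horizon h is the hitting time itself, and otherwise h is the
        horizon, which is at most r. Either way h is r clipped.\<close>
      have "r = h \<omega>" if "h \<omega> < ?T"
      proof -
        have "?\<tau> \<le> ereal (h \<omega>)"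
          unfolding hitting_time_def using hit(1) hit(4)[OF that] by (intro INF_lower) auto
        with h_le real show ?thesis by simp
      qed
      moreover have "h \<omega> \<le> r" using h_le real by simp
      moreover note h_bounds[of \<omega>]
      ultimately have "?g \<omega> \<le> \<bar>?\<eta> - r\<bar>"
        unfolding f_def by (cases "h \<omega> < ?T") (auto simp: max_def min_def abs_if)
      then show ?thesis using real by simp
    next
      case MInf
      with h_le show ?thesis by simp
    qed simp
    then show "ennreal (?g \<omega>) \<le> e2ennreal \<bar>ereal ?\<eta> - ?\<tau>\<bar>"
      by (metis e2ennreal_ereal e2ennreal_mono)
  qed
  finally show ?thesis .
qed

text \<open>As R tends to infinity the shortfall term, of order 1 / R, disappears; dividing by s
  then gives the two terms.\<close>

lemma mean_abs_error_lower_bound: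
  fixes \<eta> :: "(real \<Rightarrow> real) \<Rightarrow> real"
  assumes \<eta>: "\<eta> \<in> borel_measurable path_space"
    and e: "0 < e" and s: "0 < s" and n: "0 < n" and l: "s * n < l"
  shows "ennreal (sqrt (2 * n * e\<^sup>2 / (pi * s\<^sup>2 * (1 + e\<^sup>2))) - (2 * n / (pi ^ 3 * s ^ 6)) powr (1 / 4))
      \<le> mean_abs_error M (obs e s) (hitting_time (\<lambda>u \<omega>. drift_path s \<omega> u) l) \<eta>"
proof -
  let ?C = "sqrt (2 * n * e\<^sup>2 / (pi * (1 + e\<^sup>2))) - sqrt (2 / pi) * sqrt (sqrt (n / (2 * pi)) / s)"
  let ?r = "\<lambda>R :: nat. 3 * (real R * n)\<^sup>2 / (s * (real R * n) - l) ^ 3"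
  have "?r \<longlonglongrightarrow> 0"
    using s n by real_asymp
  then have "(\<lambda>R. ennreal ((?C - ?r R) / s)) \<longlonglongrightarrow> ennreal ((?C - 0) / s)"
    using s by (intro tendsto_intros) auto
  moreover have "eventually (\<lambda>R. ennreal ((?C - ?r R) / s)
      \<le> mean_abs_error M (obs e s) (hitting_time (\<lambda>u \<omega>. drift_path s \<omega> u) l) \<eta>) sequentially"
  proof -
    have "eventually (\<lambda>R. l < s * (real R * n)) sequentially"
      using s n by real_asymp
    with eventually_ge_at_top[of 2] show ?thesis
      by eventually_elim (rule mean_abs_error_clipped[OF \<eta> e s n l])
  qed
  ultimately have "ennreal ((?C - 0) / s) \<le> mean_abs_error M (obs e s) (hitting_time (\<lambda>u \<omega>. drift_path s \<omega> u) l) \<eta>"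
    by (rule tendsto_upperbound) simp
  moreover have "sqrt (2 * n * e\<^sup>2 / (pi * (1 + e\<^sup>2))) / s = sqrt (2 * n * e\<^sup>2 / (pi * s\<^sup>2 * (1 + e\<^sup>2)))"
    using s by (simp add: real_sqrt_divide real_sqrt_mult)
  moreover have "sqrt (2 / pi) * sqrt (sqrt (n / (2 * pi)) / s) / s = (2 * n / (pi ^ 3 * s ^ 6)) powr (1 / 4)"
  \<comment> \<open>In fourth powers: (2 / pi)^2 * (n / (2 pi)) / s^2 / s^4 = 2 n / (pi^3
    s^6).\<close>
  proof (rule power_eq_imp_eq_base[of _ 4])
    have s4: "sqrt x ^ 4 = x\<^sup>2" if "0 \<le> x" for x
      using that power_mult[of "sqrt x" 2 2] by simp
    have "(sqrt (2 / pi) * sqrt (sqrt (n / (2 * pi)) / s) / s) ^ 4 = 2 * n / (pi ^ 3 * s ^ 6)"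
      using s n by (simp add: power_mult_distrib power_divide s4) (simp add: field_simps eval_nat_numeral)
    moreover have "((2 * n / (pi ^ 3 * s ^ 6)) powr (1 / 4)) ^ 4 = 2 * n / (pi ^ 3 * s ^ 6)"
      using s n by (simp add: powr_power)
    ultimately show "(sqrt (2 / pi) * sqrt (sqrt (n / (2 * pi)) / s) / s) ^ 4 = ((2 * n / (pi ^ 3 * s ^ 6)) powr (1 / 4)) ^ 4"
      by simp
  qed (use s n in auto)
  ultimately show ?thesis
    by (simp add: diff_divide_distrib)
qed

end

theorem theorem2p5:
  fixes M :: "'a measure"
    and B N X Y :: "real \<Rightarrow> 'a \<Rightarrow> real"
    and \<epsilon> s l n :: real
  assumes "0 < \<epsilon>" and "0 < s" and "0 < l"
    and "0 < n" and "n < l / s"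
    and "standard_wiener_process M B"
    and "standard_wiener_process M N"
    and "indep_processes M B N"
    and "\<And>\<omega>. \<omega> \<in> space M \<Longrightarrow> X 0 \<omega> = 0"
    and "\<And>t \<omega>. 0 < t \<Longrightarrow> \<omega> \<in> space M \<Longrightarrow> X t \<omega> = B t \<omega> + s * t"
    and "\<And>\<omega>. \<omega> \<in> space M \<Longrightarrow> Y 0 \<omega> = 0"
    and "\<And>t \<omega>. 0 < t \<Longrightarrow> \<omega> \<in> space M \<Longrightarrow> Y t \<omega> = X t \<omega> + \<epsilon> * N t \<omega>"
  shows "(INF \<eta>\<in>borel_measurable path_space.
            enn2ereal (mean_abs_error M Y (hitting_time X l) \<eta>))
         \<ge> ereal (sqrt (2 * n * \<epsilon>\<^sup>2 / (pi * s\<^sup>2 * (1 + \<epsilon>\<^sup>2)))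
                  - (2 * n / (pi ^ 3 * s ^ 6)) powr (1 / 4)
                  - sqrt (2 * max 0 (l - s * n) / (pi * s ^ 3))
                  - (2 * n powr (3 / 2) + n / s + n powr (1 / 2) * l / s)
                      * sqrt (gaussian_Q ((l - s * n) / sqrt n)))"
    (is "_ \<ge> ereal (?a - ?b - ?c - ?d)")
proof (rule INF_greatest)
  fix \<eta> :: "(real \<Rightarrow> real) \<Rightarrow> real" assume \<eta>: "\<eta> \<in> borel_measurable path_space"
  interpret B: standard_wiener_process M B by fact
  interpret N: standard_wiener_process M N by fact
  interpret wiener_pair M B N
    by unfold_locales fact
  have sn: "s * n < l" using assms by (simp add: field_simps)
  have "gaussian_Q x \<ge> 0" for x
    unfolding gaussian_Q_def set_lebesgue_integral_def
    by (intro mult_nonneg_nonneg Bochner_Integration.integral_nonneg) auto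
  then have "0 \<le> ?c" "0 \<le> ?d"
    using assms by auto
  then have "ereal (?a - ?b - ?c - ?d) \<le> ereal (?a - ?b)"
    unfolding ereal_less_eq by linarith
  \<comment> \<open>\<open>ennreal\<close> sends a negative bound to 0, which only raises
    it.\<close>
  also have "\<dots> \<le> enn2ereal (ennreal (?a - ?b))"
  proof (cases "0 \<le> ?a - ?b")
    case True
    then show ?thesis by (simp only: enn2ereal_ennreal order_refl)
  next
    case False
    then have "ereal (?a - ?b) \<le> 0" unfolding zero_ereal_def ereal_less_eq by linarith
    also have "0 \<le> enn2ereal (ennreal (?a - ?b))" by simp
    finally show ?thesis .
  qed
  also have "\<dots> \<le> enn2ereal (mean_abs_error M (obs \<epsilon> s) (hitting_time (\<lambda>u \<omega>. drift_path s \<omega> u) l) \<eta>)"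
    using mean_abs_error_lower_bound[OF \<eta> assms(1,2,4) sn] by (simp add: less_eq_ennreal.rep_eq)
  \<comment> \<open>Off the null set where B or N does not start at 0, X and Y coincide with
    \<open>drift_path\<close> and \<open>obs\<close> at all nonnegative times.\<close>
  also have "mean_abs_error M (obs \<epsilon> s) (hitting_time (\<lambda>u \<omega>. drift_path s \<omega> u) l) \<eta>
      = mean_abs_error M Y (hitting_time X l) \<eta>"
    unfolding mean_abs_error_def
  proof (rule nn_integral_cong_AE, use B.start_at_zero N.start_at_zero AE_space in eventually_elim)
    fix \<omega> assume 0: "B 0 \<omega> = 0" "N 0 \<omega> = 0" and \<omega>: "\<omega> \<in> space M"
    have X: "X u \<omega> = drift_path s \<omega> u" if "0 \<le> u" for u
      using that 0 \<omega> assms(9,10) by (cases "u = 0") (auto simp: drift_path_def)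
    have Y: "Y u \<omega> = obs \<epsilon> s u \<omega>" if "0 \<le> u" for u
      using that 0 \<omega> assms(11,12) X[of u] by (cases "u = 0") (auto simp: obs_def drift_path_def)
    have "sample_path Y \<omega> = sample_path (obs \<epsilon> s) \<omega>"
      unfolding sample_path_def using Y by (intro restrict_ext) simp
    moreover have "hitting_time X l \<omega> = hitting_time (\<lambda>u \<omega>. drift_path s \<omega> u) l \<omega>"
      unfolding hitting_time_def using X by (intro arg_cong[where f="\<lambda>A. Inf (ereal ` A)"]) auto
    ultimately show "e2ennreal \<bar>ereal (\<eta> (sample_path (obs \<epsilon> s) \<omega>)) - hitting_time (\<lambda>u \<omega>. drift_path s \<omega> u) l \<omega>\<bar>
        = e2ennreal \<bar>ereal (\<eta> (sample_path Y \<omega>)) - hitting_time X l \<omega>\<bar>"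
      by simp
  qed
  finally show "ereal (?a - ?b - ?c - ?d) \<le> enn2ereal (mean_abs_error M Y (hitting_time X l) \<eta>)" .
qed

end
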